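(* Let $\sigma_0>0$, $\alpha_0\in\mathbb{R}$. For $h(t,\cdot):\mathbb{S}^1\to(-1,\infty)$ and $\psi(t,\cdot):\mathbb{S}^1\to\mathbb{R}$ put $\xi(t,\theta):=\log(1+h(t,(\cos\theta,\sin\theta)))$ and $\chi(t,\theta):=\psi(t,(\cos\theta,\sin\theta))$, $\theta\in\mathbb{T}^1=\mathbb{R}/2\pi\mathbb{Z}$. Then the equations on $\mathbb{S}^1$ $$\partial_th=\frac{J}{1+h}\,G(h)\psi+\frac{\alpha_0}{2}\mathcal{M}h,$$ $$\partial_t\psi=\frac12\Big(G(h)\psi+\frac{\langle\nabla_{\mathbb{S}^1}\psi,\nabla_{\mathbb{S}^1}h\rangle}{J(1+h)}\Big)^2-\frac{|\nabla_{\mathbb{S}^1}\psi|^2}{2(1+h)^2}-\sigma_0H(h)+\frac{\alpha_0}{2}\mathcal{M}\psi+\frac{\alpha_0^2}{8}(1+h)^2+\alpha_0K(h)\psi+\sigma_0-\frac{\alpha_0^2}{8}$$ can be written, for $(t,\theta)\in\mathbb{R}\times\mathbb{T}^1$, as $$\partial_t\xi=e^{-2\xi}\Big[\bar G(\xi)\chi+\frac{\alpha_0}{2}e^{2\xi}\xi'\Big],$$ $$\partial_t\chi=e^{-2\xi}\Big[\frac12\Big(\frac{\bar G(\xi)\chi+\xi'\chi'}{\sqrt{1+\xi'^2}}\Big)^2-\frac12\chi'^2+\sigma_0e^{\xi}\Big(\Big(\frac{\xi'}{\sqrt{1+\xi'^2}}\Big)'-\frac1{\sqrt{1+\xi'^2}}\Big)\Big]+\frac{\alpha_0}{2}\chi'+\frac{\alpha_0^2}{8}e^{2\xi}+\alpha_0\bar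 K(\xi)\chi+\sigma_0-\frac{\alpha_0^2}{8}.$$
   Context: All functions are smooth enough for classical solutions. Prime denotes $\partial_\theta$. $\mathcal{J}=\begin{pmatrix}0&-1\\1&0\end{pmatrix}$; $\nabla_{\mathbb{S}^1}$ is the tangential gradient on the unit circle; $J=\sqrt{(1+h)^2+|\nabla_{\mathbb{S}^1}h|^2}$; $\mathcal{M}f(x)=\langle\nabla_{\mathbb{S}^1}f(x),\mathcal{J}x\rangle$. $\Omega_h$ is the domain bounded by $\{\gamma_h(x)=(1+h(x))x:x\in\mathbb{S}^1\}$, with outward unit normal $\nu_h$; $H(h)$ is its boundary curvature (equal to $1$ for the unit disk) evaluated at $\gamma_h(x)$. $\Phi$ is the harmonic function in $\Omega_h$ with $\Phi\circ\gamma_h=\psi$; $G(h)\psi=\langle\nabla\Phi\circ\gamma_h,\nu_h\circ\gamma_h\rangle$; $\Psi$ is a harmonic conjugate, $\nabla\Psi=\mathcal{J}\nabla\Phi$ (with a fixed normalization of the additive constant), and $K(h)\psi=\Psi\circ\gamma_h$. On the torus: $\bar G(\xi)\chi$ is the infinite-depth Dirichlet–Neumann operator, $\bar G(\xi)\chi(\theta)=(\partial_\rho\tilde\Phi-\xi'\partial_\theta\tilde\Phi)(\xi(\theta),\theta)$, where $\tilde\Phi(\rho,\theta)$ is harmonic in $\{(\rho,\theta):\theta\in\mathbb{T}^1,\ \rho<\xi(\theta)\}$, $\tilde\Phi(\xi(\theta),\theta)=\chi(\theta)$ and $\partial_\rho\tilde\Phi\to0$ as $\rho\to-\infty$. $\bar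 K(\xi)\chi(\theta):=(K(h)\psi)(\cos\theta,\sin\theta)$, i.e. the boundary trace $\Psi(e^{\xi(\theta)}\cos\theta,e^{\xi(\theta)}\sin\theta)$. *)

theory Defs
  imports "HOL-Analysis.Analysis"
begin

text \<open>
  The plane is the type \<^typ>\<open>complex\<close> with its real inner product. Functions on the unit circle
  have type \<^typ>\<open>complex \<Rightarrow> real\<close>; only their values on the circle are ever used. Functions on the
  torus are \<open>2\<pi>\<close>-periodic functions of a real variable.
\<close>

abbreviation circle :: "complex set" where
  "circle \<equiv> sphere 0 1"

definition rotJ :: "complex \<Rightarrow> complex" where
  "rotJ z = Complex (- Im z) (Re z)"

definition C_circle :: "nat \<Rightarrow> (complex \<Rightarrow> real) \<Rightarrow> bool" where
  "C_circle k f \<longleftrightarrow>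
     (\<forall>j<k. (deriv ^^ j) (\<lambda>\<theta>::real. f (cis \<theta>)) differentiable_on UNIV) \<and>
     continuous_on UNIV ((deriv ^^ k) (\<lambda>\<theta>::real. f (cis \<theta>)))"

definition tgrad :: "(complex \<Rightarrow> real) \<Rightarrow> complex \<Rightarrow> complex" where
  "tgrad f x = (THE v. v \<bullet> x = 0 \<and> (f has_derivative (\<lambda>w. v \<bullet> w)) (at x within circle))"

definition Mop :: "(complex \<Rightarrow> real) \<Rightarrow> complex \<Rightarrow> real" where
  "Mop f x = tgrad f x \<bullet> rotJ x"

definition Jac :: "(complex \<Rightarrow> real) \<Rightarrow> complex \<Rightarrow> real" where
  "Jac h x = sqrt ((1 + h x)\<^sup>2 + (norm (tgrad h x))\<^sup>2)"

definition bdry :: "(complex \<Rightarrow> real) \<Rightarrow> complex \<Rightarrow> complex" where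
  "bdry h x = (1 + h x) *\<^sub>R x"

definition star_dom :: "(complex \<Rightarrow> real) \<Rightarrow> complex set" where
  "star_dom h = inside (bdry h ` circle)"

text \<open>Counterclockwise parametrization of the boundary that passes through \<open>bdry h x\<close> at parameter 0.\<close>

definition bdry_curve :: "(complex \<Rightarrow> real) \<Rightarrow> complex \<Rightarrow> real \<Rightarrow> complex" where
  "bdry_curve h x s = bdry h (x * cis s)"

definition outer_normal :: "(complex \<Rightarrow> real) \<Rightarrow> complex \<Rightarrow> complex" where
  "outer_normal h x = (THE n. norm n = 1
     \<and> n \<bullet> vector_derivative (bdry_curve h x) (at 0) = 0
     \<and> (\<forall>\<^sub>F s in at_right 0. bdry h x + s *\<^sub>R n \<notin> star_dom h))"

text \<open>Signed curvature \<open>det (c', c'') / |c'|\<^sup>3\<close> of a parametrized plane curve; it is positive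
  for a counterclockwise circle.\<close>

definition curve_curvature :: "(real \<Rightarrow> complex) \<Rightarrow> real \<Rightarrow> real" where
  "curve_curvature c s =
     (let c1 = vector_derivative c (at s);
          c2 = vector_derivative (\<lambda>r. vector_derivative c (at r)) (at s)
      in (rotJ c1 \<bullet> c2) / norm c1 ^ 3)"

definition bdry_curvature :: "(complex \<Rightarrow> real) \<Rightarrow> complex \<Rightarrow> real" where
  "bdry_curvature h x = curve_curvature (bdry_curve h x) 0"

text \<open>Twice continuously differentiable with vanishing Laplacian (\<open>D\<close> is the gradient, \<open>D2\<close> its
  derivative, and the Laplacian is the trace of \<open>D2\<close>).\<close>

definition harmonic_on :: "complex set \<Rightarrow> (complex \<Rightarrow> real) \<Rightarrow> bool" where
  "harmonic_on S \<Phi> \<longleftrightarrow> open S \<and>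
     (\<exists>D D2. (\<forall>z\<in>S. GDERIV \<Phi> z :> D z) \<and>
             (\<forall>z\<in>S. (D has_derivative D2 z) (at z)) \<and>
             (\<forall>v. continuous_on S (\<lambda>z. D2 z v)) \<and>
             (\<forall>z\<in>S. (\<Sum>b\<in>Basis. D2 z b \<bullet> b) = 0))"

text \<open>\<open>\<Phi>\<close> is harmonic in the open set \<open>S\<close> and continuously differentiable up to the boundary, and
  \<open>D\<close> is its gradient, continuously extended to the boundary.\<close>

definition classical_harmonic ::
  "complex set \<Rightarrow> (complex \<Rightarrow> real) \<Rightarrow> (complex \<Rightarrow> complex) \<Rightarrow> bool" where
  "classical_harmonic S \<Phi> D \<longleftrightarrow>
     harmonic_on S \<Phi> \<and> (\<forall>z\<in>S. GDERIV \<Phi> z :> D z) \<and>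
     continuous_on (closure S) \<Phi> \<and> continuous_on (closure S) D"

definition dirichlet_solution ::
  "(complex \<Rightarrow> real) \<Rightarrow> (complex \<Rightarrow> real) \<Rightarrow> (complex \<Rightarrow> real) \<Rightarrow> (complex \<Rightarrow> complex) \<Rightarrow> bool" where
  "dirichlet_solution h \<psi> \<Phi> D \<longleftrightarrow>
     classical_harmonic (star_dom h) \<Phi> D \<and> (\<forall>x\<in>circle. \<Phi> (bdry h x) = \<psi> x)"

text \<open>For sufficiently smooth data the solution exists, and it is unique on the closed domain. The
  operators below are totalized by the value 0 for data without a classical solution.\<close>

definition DN :: "(complex \<Rightarrow> real) \<Rightarrow> (complex \<Rightarrow> real) \<Rightarrow> complex \<Rightarrow> real" where
  "DN h \<psi> x =
     (if \<exists>\<Phi> D. dirichlet_solution h \<psi> \<Phi> D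
      then (SOME D. \<exists>\<Phi>. dirichlet_solution h \<psi> \<Phi> D) (bdry h x) \<bullet> outer_normal h x
      else 0)"

text \<open>
  The additive constant of the harmonic conjugate is fixed by prescribing its value at the origin,
  which lies in every domain. The normalization \<open>N\<close> may depend on the data, that is, on the
  restrictions of \<open>h\<close> and \<open>\<psi>\<close> to the circle; thus every normalization rule (value at the origin,
  boundary mean, and so on) is given by some \<open>N\<close>.
\<close>

type_synonym normalization = "(complex \<Rightarrow> real) \<Rightarrow> (complex \<Rightarrow> real) \<Rightarrow> real"

definition harmonic_conjugate ::
  "normalization \<Rightarrow> (complex \<Rightarrow> real) \<Rightarrow> (complex \<Rightarrow> real) \<Rightarrow> (complex \<Rightarrow> real) \<Rightarrow> bool" where
  "harmonic_conjugate N h \<psi> \<Psi> \<longleftrightarrow>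
     (\<exists>\<Phi> D. dirichlet_solution h \<psi> \<Phi> D \<and> (\<forall>z\<in>star_dom h. GDERIV \<Psi> z :> rotJ (D z))) \<and>
     continuous_on (closure (star_dom h)) \<Psi> \<and>
     \<Psi> 0 = N (restrict h circle) (restrict \<psi> circle)"

definition conj_trace ::
  "normalization \<Rightarrow> (complex \<Rightarrow> real) \<Rightarrow> (complex \<Rightarrow> real) \<Rightarrow> complex \<Rightarrow> real" where
  "conj_trace N h \<psi> x =
     (if \<exists>\<Psi>. harmonic_conjugate N h \<psi> \<Psi>
      then (SOME \<Psi>. harmonic_conjugate N h \<psi> \<Psi>) (bdry h x)
      else 0)"

text \<open>In the half-cylinder the point \<open>(\<rho>, \<theta>)\<close> is \<^term>\<open>Complex \<rho> \<theta>\<close>, so that the partial derivatives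
  in \<open>\<rho>\<close> and \<open>\<theta>\<close> are the real and imaginary part of the gradient. The decay as \<open>\<rho> \<rightarrow> -\<infinity>\<close> is
  uniform in \<open>\<theta>\<close>.\<close>

definition half_cyl :: "(real \<Rightarrow> real) \<Rightarrow> complex set" where
  "half_cyl \<xi> = {w. Re w < \<xi> (Im w)}"

definition cyl_solution ::
  "(real \<Rightarrow> real) \<Rightarrow> (real \<Rightarrow> real) \<Rightarrow> (complex \<Rightarrow> real) \<Rightarrow> (complex \<Rightarrow> complex) \<Rightarrow> bool" where
  "cyl_solution \<xi> chi \<Phi> D \<longleftrightarrow>
     classical_harmonic (half_cyl \<xi>) \<Phi> D \<and>
     (\<forall>\<rho> \<theta>. \<rho> \<le> \<xi> \<theta> \<longrightarrow> \<Phi> (Complex \<rho> (\<theta> + 2 * pi)) = \<Phi> (Complex \<rho> \<theta>)) \<and>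
     (\<forall>\<theta>. \<Phi> (Complex (\<xi> \<theta>) \<theta>) = chi \<theta>) \<and>
     ((\<lambda>w. Re (D w)) \<longlongrightarrow> 0) (filtercomap Re at_bot)"

definition DN_cyl :: "(real \<Rightarrow> real) \<Rightarrow> (real \<Rightarrow> real) \<Rightarrow> real \<Rightarrow> real" where
  "DN_cyl \<xi> chi \<theta> =
     (if \<exists>\<Phi> D. cyl_solution \<xi> chi \<Phi> D
      then (let g = (SOME D. \<exists>\<Phi>. cyl_solution \<xi> chi \<Phi> D) (Complex (\<xi> \<theta>) \<theta>)
            in Re g - deriv \<xi> \<theta> * Im g)
      else 0)"

text \<open>Here \<open>h\<close> and \<open>\<psi>\<close> are recovered from \<open>\<xi> = log (1 + h)\<close> and \<open>chi\<close>.\<close>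

definition conj_trace_cyl :: "normalization \<Rightarrow> (real \<Rightarrow> real) \<Rightarrow> (real \<Rightarrow> real) \<Rightarrow> real \<Rightarrow> real" where
  "conj_trace_cyl N \<xi> chi \<theta> =
     conj_trace N (\<lambda>x. exp (\<xi> (Arg x)) - 1) (\<lambda>x. chi (Arg x)) (cis \<theta>)"

definition circle_rhs_h ::
  "real \<Rightarrow> (complex \<Rightarrow> real) \<Rightarrow> (complex \<Rightarrow> real) \<Rightarrow> complex \<Rightarrow> real" where
  "circle_rhs_h \<alpha> h \<psi> x = Jac h x / (1 + h x) * DN h \<psi> x + \<alpha> / 2 * Mop h x"

definition circle_rhs_psi ::
  "normalization \<Rightarrow> real \<Rightarrow> real \<Rightarrow> (complex \<Rightarrow> real) \<Rightarrow> (complex \<Rightarrow> real) \<Rightarrow> complex \<Rightarrow> real" where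
  "circle_rhs_psi N \<sigma> \<alpha> h \<psi> x =
     1 / 2 * (DN h \<psi> x + (tgrad \<psi> x \<bullet> tgrad h x) / (Jac h x * (1 + h x)))\<^sup>2
     - (norm (tgrad \<psi> x))\<^sup>2 / (2 * (1 + h x)\<^sup>2)
     - \<sigma> * bdry_curvature h x
     + \<alpha> / 2 * Mop \<psi> x
     + \<alpha>\<^sup>2 / 8 * (1 + h x)\<^sup>2
     + \<alpha> * conj_trace N h \<psi> x
     + \<sigma> - \<alpha>\<^sup>2 / 8"

definition torus_rhs_xi :: "real \<Rightarrow> (real \<Rightarrow> real) \<Rightarrow> (real \<Rightarrow> real) \<Rightarrow> real \<Rightarrow> real" where
  "torus_rhs_xi \<alpha> \<xi> chi \<theta> =
     exp (- 2 * \<xi> \<theta>) * (DN_cyl \<xi> chi \<theta> + \<alpha> / 2 * exp (2 * \<xi> \<theta>) * deriv \<xi> \<theta>)"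

definition torus_rhs_chi ::
  "normalization \<Rightarrow> real \<Rightarrow> real \<Rightarrow> (real \<Rightarrow> real) \<Rightarrow> (real \<Rightarrow> real) \<Rightarrow> real \<Rightarrow> real" where
  "torus_rhs_chi N \<sigma> \<alpha> \<xi> chi \<theta> =
     exp (- 2 * \<xi> \<theta>) *
       (1 / 2 * ((DN_cyl \<xi> chi \<theta> + deriv \<xi> \<theta> * deriv chi \<theta>) / sqrt (1 + (deriv \<xi> \<theta>)\<^sup>2))\<^sup>2
        - 1 / 2 * (deriv chi \<theta>)\<^sup>2
        + \<sigma> * exp (\<xi> \<theta>) *
            (deriv (\<lambda>s. deriv \<xi> s / sqrt (1 + (deriv \<xi> s)\<^sup>2)) \<theta>
             - 1 / sqrt (1 + (deriv \<xi> \<theta>)\<^sup>2)))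
     + \<alpha> / 2 * deriv chi \<theta>
     + \<alpha>\<^sup>2 / 8 * exp (2 * \<xi> \<theta>)
     + \<alpha> * conj_trace_cyl N \<xi> chi \<theta>
     + \<sigma> - \<alpha>\<^sup>2 / 8"

end

theory Submission
  imports Defs "HOL-Complex_Analysis.Complex_Analysis"
begin

text \<open>
  The complex exponential maps the half-cylinder \<open>\<rho> < \<xi> \<theta>\<close> conformally onto the punctured domain,
  so a solution \<open>\<Phi>\<close> in the domain pulls back to \<open>\<Phi> \<circ> exp\<close>, and the two Dirichlet-Neumann operators differ
  by the conformal factor \<open>J = e\<^sup>\<xi> sqrt (1 + \<xi>'\<^sup>2)\<close>.
  Since the operators are defined through solutions that need not exist, the converse is needed as well:
  a solution on the half-cylinder descends to the punctured domain, and the puncture is removable.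
  Indeed \<open>z (\<Phi>\<^sub>x - i \<Phi>\<^sub>y)\<close> is holomorphic there and its real part \<open>r \<Phi>\<^sub>r\<close> tends to 0 by the
  decay condition, hence it has a limit at the origin; by Rolle's theorem and periodicity its imaginary
  part \<open>- \<Phi>\<^sub>\<theta>\<close> vanishes at points arbitrarily close to the origin, so the limit is 0 and
  \<open>\<Phi>\<^sub>x - i \<Phi>\<^sub>y\<close> extends holomorphically.
\<close>

section \<open>Gradients of harmonic functions\<close>

text \<open>Gradients are complex numbers \<open>D z\<close>, and a function with gradient
  \<open>D\<close> on an open set is harmonic exactly when \<open>cnj (D z)\<close> is holomorphic.
  This criterion passes through composition with \<open>exp\<close> and \<open>Ln\<close>, through
  differences and through the removal of a puncture, so second derivatives appear only in its proof.
  The obstacle is that \<open>DN\<close> and \<open>DN_cyl\<close> pick a solution by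
  \<open>SOME\<close> and fall back to 0 if there is none. Uniqueness is proved on the bounded
  starlike domain, for gradients up to the boundary, and whatever \<open>DN_cyl\<close> picks is
  transported there before it is compared. If one side has no solution, neither has the other, and
  the identity between the operators reads 0 = 0. Since \<open>Ln\<close> jumps on the negative
  axis, continuity and differentiability after descent are obtained from the local branch
  \<open>Ln z\<^sub>0 + Ln (z / z\<^sub>0)\<close>, which periodic functions cannot tell from
  \<open>Ln\<close>. The conjugate trace needs no transport: \<open>conj_trace_cyl\<close> is the
  circle operator applied to data rebuilt through \<open>Arg\<close>, so the point is that it sees
  only values on the circle.\<close>

lemma GDERIV_unique:
  assumes "GDERIV f x :> d" "GDERIV f x :> d'"
  shows "d = d'"
proof -
  have "(\<lambda>h. h \<bullet> d) = (\<lambda>h. h \<bullet> d')"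
    using assms unfolding gderiv_def by (rule has_derivative_unique)
  then show ?thesis by (metis inner_eq_zero_iff inner_diff_right right_minus_eq)
qed

text \<open>The mean value theorem along \<open>u\<close> turns the mixed second difference into
  \<open>t\<close> times a difference of gradients, which differentiability of \<open>D\<close> at
  \<open>z\<close> evaluates up to o(t). The second difference is symmetric in \<open>u\<close> and
  \<open>v\<close>, and that is its use: it forces the limit \<open>u \<bullet> L v\<close> to be
  symmetric too.\<close>

lemma second_difference_bound:
  fixes \<Phi> :: "'a::real_inner \<Rightarrow> real"
  assumes "open S" "z \<in> S" and grad: "\<And>w. w \<in> S \<Longrightarrow> GDERIV \<Phi> w :> D w"
    and L: "(D has_derivative L) (at z)" and "e > 0"
  obtains d where "d > 0" and "\<And>t. 0 < t \<Longrightarrow> t < d \<Longrightarrow>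
     \<bar>\<Phi> (z + t *\<^sub>R u + t *\<^sub>R v) - \<Phi> (z + t *\<^sub>R u) - \<Phi> (z + t *\<^sub>R v) + \<Phi> z - t\<^sup>2 * (u \<bullet> L v)\<bar> \<le> e * t\<^sup>2"
proof -
  interpret L: bounded_linear L using L by (rule has_derivative_bounded_linear)
  define K where "K = norm u + norm v + 1"
  have K: "K > 0" "norm u \<le> K" by (auto simp: K_def add_nonneg_pos)
  \<comment> \<open>The final estimate is \<open>t * K * 2 * e' * (t * K)\<close>: one factor
    \<open>K\<close> bounds \<open>u\<close>, the other the size of the displacement, and 2 counts
    the two error terms.\<close>
  define e' where "e' = e / (2 * K\<^sup>2)"
  have "e' > 0" using \<open>e > 0\<close> K by (simp add: e'_def)
  then obtain d1 where d1: "d1 > 0"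
    "\<And>y. norm (y - z) < d1 \<Longrightarrow> norm (D y - D z - L (y - z)) \<le> e' * norm (y - z)"
    using L unfolding has_derivative_at_alt by blast
  obtain d2 where d2: "d2 > 0" "ball z d2 \<subseteq> S"
    using \<open>open S\<close> \<open>z \<in> S\<close> openE by blast
  \<comment> \<open>Displacements \<open>s u + r v\<close> with \<open>s\<close>, \<open>r\<close>
    in [0, t] have norm at most \<open>t * K\<close>, hence stay below both \<open>d1\<close> and
    \<open>d2\<close>.\<close>
  define d where "d = min d1 d2 / K"
  have "d > 0" using d1 d2 K by (simp add: d_def)
  moreover have "\<bar>\<Phi> (z + t *\<^sub>R u + t *\<^sub>R v) - \<Phi> (z + t *\<^sub>R u) - \<Phi> (z + t *\<^sub>R v) + \<Phi> z - t\<^sup>2 * (u \<bullet> L v)\<bar> \<le> e * t\<^sup>2"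
    if t: "0 < t" "t < d" for t
  proof -
    have tK: "t * K < d1" "t * K < d2"
      using t K by (auto simp: d_def field_simps)
    have le: "norm (s *\<^sub>R u + r *\<^sub>R v) \<le> t * K" if "0 \<le> s" "s \<le> t" "0 \<le> r" "r \<le> t" for s r
    proof -
      have "norm (s *\<^sub>R u + r *\<^sub>R v) \<le> s * norm u + r * norm v"
        using norm_triangle_ineq[of "s *\<^sub>R u" "r *\<^sub>R v"] that by simp
      also have "\<dots> \<le> t * norm u + t * norm v"
        using that by (intro add_mono mult_right_mono) auto
      also have "\<dots> \<le> t * K" using t by (simp add: K_def algebra_simps)
      finally show ?thesis .
    qed
    have inS: "z + s *\<^sub>R u + r *\<^sub>R v \<in> S" if "0 \<le> s" "s \<le> t" "0 \<le> r" "r \<le> t" for s r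
    proof -
      have "dist (z + (s *\<^sub>R u + r *\<^sub>R v)) z < d2"
        using le[OF that] tK unfolding dist_norm by (simp only: add_diff_cancel_left')
      then show ?thesis using d2 by (auto simp: dist_commute add.assoc)
    qed
    have der: "((\<lambda>s. \<Phi> (z + s *\<^sub>R u + r *\<^sub>R v)) has_real_derivative (u \<bullet> D (z + s *\<^sub>R u + r *\<^sub>R v))) (at s)"
      if "0 \<le> s" "s \<le> t" "0 \<le> r" "r \<le> t" for s r
    proof -
      have "(\<Phi> has_derivative (\<lambda>x. x \<bullet> D (z + s *\<^sub>R u + r *\<^sub>R v))) (at (z + s *\<^sub>R u + r *\<^sub>R v))"
        using grad[OF inS[OF that]] by (simp add: gderiv_def)
      then have "((\<Phi> \<circ> (\<lambda>s. z + s *\<^sub>R u + r *\<^sub>R v)) has_derivative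
          ((\<lambda>x. x \<bullet> D (z + s *\<^sub>R u + r *\<^sub>R v)) \<circ> (\<lambda>x. x *\<^sub>R u))) (at s)"
        by (intro diff_chain_at) (auto intro!: derivative_eq_intros)
      then show ?thesis
        by (simp add: o_def has_field_derivative_def mult_commute_abs)
    qed
    define \<phi> where "\<phi> s = \<Phi> (z + s *\<^sub>R u + t *\<^sub>R v) - \<Phi> (z + s *\<^sub>R u + 0 *\<^sub>R v)" for s
    have "\<exists>s. 0 < s \<and> s < t \<and> \<phi> t - \<phi> 0 = (t - 0) * (u \<bullet> D (z + s *\<^sub>R u + t *\<^sub>R v) - u \<bullet> D (z + s *\<^sub>R u + 0 *\<^sub>R v))"
      unfolding \<phi>_def using t by (intro MVT2) (auto intro!: DERIV_diff der[where r = 0, simplified] der)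
    then obtain s where s: "0 < s" "s < t"
      "\<phi> t - \<phi> 0 = t * (u \<bullet> (D (z + s *\<^sub>R u + t *\<^sub>R v) - D (z + s *\<^sub>R u)))"
      by (auto simp: inner_diff_right)
    define E where "E y = D (z + y) - D z - L y" for y
    have E: "norm (E (s *\<^sub>R u + r *\<^sub>R v)) \<le> e' * (t * K)" if "0 \<le> r" "r \<le> t" for r
    proof -
      have "norm (s *\<^sub>R u + r *\<^sub>R v) \<le> t * K" using le that s by simp
      moreover from this have "norm (E (s *\<^sub>R u + r *\<^sub>R v)) \<le> e' * norm (s *\<^sub>R u + r *\<^sub>R v)"
        using d1(2)[of "z + (s *\<^sub>R u + r *\<^sub>R v)"] tK by (simp add: E_def)
      ultimately show ?thesis using \<open>e' > 0\<close> by (meson mult_left_mono less_imp_le order_trans)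
    qed
    \<comment> \<open>Both points contain the same displacement \<open>s u\<close>, so its linear
      contribution cancels and only \<open>t L v\<close> survives besides the errors.\<close>
    have "D (z + s *\<^sub>R u + t *\<^sub>R v) - D (z + s *\<^sub>R u) =
      t *\<^sub>R L v + (E (s *\<^sub>R u + t *\<^sub>R v) - E (s *\<^sub>R u + 0 *\<^sub>R v))"
      by (simp add: E_def L.add L.scaleR algebra_simps)
    then have "\<phi> t - \<phi> 0 - t\<^sup>2 * (u \<bullet> L v) = t * (u \<bullet> (E (s *\<^sub>R u + t *\<^sub>R v) - E (s *\<^sub>R u + 0 *\<^sub>R v)))"
      unfolding s(3) by (simp only: inner_add_right inner_scaleR_right distrib_left power2_eq_square)
    also have "\<bar>\<dots>\<bar> \<le> t * (norm u * norm (E (s *\<^sub>R u + t *\<^sub>R v) - E (s *\<^sub>R u + 0 *\<^sub>R v)))"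
      using t by (simp add: abs_mult Cauchy_Schwarz_ineq2)
    also have "\<dots> \<le> t * (K * (2 * e' * (t * K)))"
    proof -
      have "norm (E (s *\<^sub>R u + t *\<^sub>R v) - E (s *\<^sub>R u + 0 *\<^sub>R v)) \<le> 2 * e' * (t * K)"
        using norm_triangle_ineq4[of "E (s *\<^sub>R u + t *\<^sub>R v)" "E (s *\<^sub>R u + 0 *\<^sub>R v)"] E[of t] E[of 0] t
        by linarith
      then show ?thesis using K t by (intro mult_left_mono mult_mono) auto
    qed
    also have "\<dots> = e * t\<^sup>2" using K by (simp add: e'_def field_simps power2_eq_square)
    finally show ?thesis by (simp add: \<phi>_def algebra_simps)
  qed
  ultimately show ?thesis using that by blast
qed

lemma second_derivative_symmetric:
  fixes \<Phi> :: "'a::real_inner \<Rightarrow> real"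
  assumes "open S" "z \<in> S" and grad: "\<And>w. w \<in> S \<Longrightarrow> GDERIV \<Phi> w :> D w"
    and L: "(D has_derivative L) (at z)"
  shows "u \<bullet> L v = v \<bullet> L u"
proof (rule ccontr)
  assume ne: "u \<bullet> L v \<noteq> v \<bullet> L u"
  \<comment> \<open>The two second differences agree, so the two limits differ by at most
    \<open>2 * e\<close>; a third of the supposed gap makes this contradictory.\<close>
  define e where "e = \<bar>u \<bullet> L v - v \<bullet> L u\<bar> / 3"
  have e: "e > 0" using ne by (simp add: e_def)
  obtain d1 where d1: "d1 > 0" "\<And>t. 0 < t \<Longrightarrow> t < d1 \<Longrightarrow>
     \<bar>\<Phi> (z + t *\<^sub>R u + t *\<^sub>R v) - \<Phi> (z + t *\<^sub>R u) - \<Phi> (z + t *\<^sub>R v) + \<Phi> z - t\<^sup>2 * (u \<bullet> L v)\<bar> \<le> e * t\<^sup>2"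
    by (rule second_difference_bound[OF assms e]) auto
  obtain d2 where d2: "d2 > 0" "\<And>t. 0 < t \<Longrightarrow> t < d2 \<Longrightarrow>
     \<bar>\<Phi> (z + t *\<^sub>R v + t *\<^sub>R u) - \<Phi> (z + t *\<^sub>R v) - \<Phi> (z + t *\<^sub>R u) + \<Phi> z - t\<^sup>2 * (v \<bullet> L u)\<bar> \<le> e * t\<^sup>2"
    by (rule second_difference_bound[OF assms e]) auto
  define t where "t = min d1 d2 / 2"
  have t: "0 < t" "t < d1" "t < d2" using d1(1) d2(1) by (auto simp: t_def)
  have "z + t *\<^sub>R v + t *\<^sub>R u = z + t *\<^sub>R u + t *\<^sub>R v" by simp
  with d1(2)[of t] d2(2)[of t] t
  have "\<bar>t\<^sup>2 * (u \<bullet> L v) - t\<^sup>2 * (v \<bullet> L u)\<bar> \<le> 2 * (e * t\<^sup>2)" by (simp add: abs_le_iff)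
  then have "t\<^sup>2 * (3 * e) \<le> t\<^sup>2 * (2 * e)"
    unfolding right_diff_distrib[symmetric] by (simp add: abs_mult e_def)
  with t e show False by simp
qed

text \<open>Cauchy-Riemann for \<Phi>_x - i \<Phi>_y: one equation is the symmetry of the second
  derivative, the other the vanishing trace. The gradient inside \<open>harmonic_on\<close> is
  existentially bound, and uniqueness of gradients identifies it with \<open>D\<close>.\<close>

lemma harmonic_on_cnj_gradient_holomorphic:
  assumes "harmonic_on S \<Phi>" and grad: "\<And>z. z \<in> S \<Longrightarrow> GDERIV \<Phi> z :> D z"
  shows "(\<lambda>z. cnj (D z)) holomorphic_on S"
proof -
  obtain D' D2 where S: "open S" and D': "\<And>z. z \<in> S \<Longrightarrow> GDERIV \<Phi> z :> D' z"
    and D2: "\<And>z. z \<in> S \<Longrightarrow> (D' has_derivative D2 z) (at z)"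
    and tr: "\<And>z. z \<in> S \<Longrightarrow> (\<Sum>b\<in>Basis. D2 z b \<bullet> b) = 0"
    using assms(1) unfolding harmonic_on_def by blast
  have eq: "D z = D' z" if "z \<in> S" for z
    using GDERIV_unique[OF grad[OF that] D'[OF that]] .
  have "\<exists>f'. ((\<lambda>z. cnj (D' z)) has_field_derivative f') (at z)" if z: "z \<in> S" for z
  proof -
    interpret B: bounded_linear "D2 z" using D2[OF z] by (rule has_derivative_bounded_linear)
    have sym: "1 \<bullet> D2 z \<i> = \<i> \<bullet> D2 z 1" by (rule second_derivative_symmetric[OF S z D' D2[OF z]])
    have trace: "Re (D2 z 1) + Im (D2 z \<i>) = 0"
      using tr[OF z] by (simp add: Basis_complex_def inner_complex_def)
    have "cnj (D2 z v) = cnj (D2 z 1) * v" for v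
    proof -
      have "D2 z v = D2 z (Re v *\<^sub>R 1 + Im v *\<^sub>R \<i>)" by (rule arg_cong[of _ _ "D2 z"]) (simp add: complex_eq_iff)
      also have "\<dots> = Re v *\<^sub>R D2 z 1 + Im v *\<^sub>R D2 z \<i>" by (simp only: B.add B.scaleR)
      finally show ?thesis using sym trace
        by (simp add: complex_eq_iff inner_complex_def algebra_simps eq_neg_iff_add_eq_0)
          (metis add.commute add_eq_0_iff mult_minus_right)
    qed
    then have "(\<lambda>v. cnj (D2 z v)) = (*) (cnj (D2 z 1))" by blast
    then have "((\<lambda>z. cnj (D' z)) has_field_derivative cnj (D2 z 1)) (at z)"
      using bounded_linear.has_derivative[OF bounded_linear_cnj D2[OF z]]
      by (simp add: has_field_derivative_def)
    then show ?thesis ..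
  qed
  then have "(\<lambda>z. cnj (D' z)) holomorphic_on S"
    using S by (simp add: holomorphic_on_open)
  then show ?thesis by (rule holomorphic_transform) (simp add: eq)
qed

text \<open>With \<open>f = cnj D\<close>, the derivative of \<open>D\<close> is
  \<open>v \<mapsto> cnj (f' v)\<close>. Its diagonal entries in the basis 1, i are Re f' and - Re
  f', so the trace vanishes, and it is continuous because f' is again holomorphic.\<close>

lemma harmonic_on_if_cnj_gradient_holomorphic:
  assumes "open S" and grad: "\<And>z. z \<in> S \<Longrightarrow> GDERIV \<Phi> z :> D z"
    and hol: "(\<lambda>z. cnj (D z)) holomorphic_on S"
  shows "harmonic_on S \<Phi>"
proof -
  define f where "f z = cnj (D z)" for z
  have f: "f holomorphic_on S" using hol unfolding f_def[abs_def] .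
  define D2 where "D2 z v = cnj (deriv f z * v)" for z v
  have "(D has_derivative D2 z) (at z)" if "z \<in> S" for z
  proof -
    have "(f has_field_derivative deriv f z) (at z)"
      using f \<open>open S\<close> that by (rule holomorphic_derivI)
    then have "((\<lambda>z. cnj (f z)) has_derivative D2 z) (at z)"
      unfolding has_field_derivative_def D2_def by (rule bounded_linear.has_derivative[OF bounded_linear_cnj])
    then show ?thesis by (simp add: f_def)
  qed
  moreover have "continuous_on S (\<lambda>z. D2 z v)" for v
    unfolding D2_def using holomorphic_on_imp_continuous_on[OF holomorphic_deriv[OF f \<open>open S\<close>]]
    by (intro continuous_intros)
  moreover have "(\<Sum>b\<in>Basis. D2 z b \<bullet> b) = 0" for z
    by (simp add: D2_def Basis_complex_def inner_complex_def)
  ultimately show ?thesis unfolding harmonic_on_def using assms(1,2) by blast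
qed

lemma classical_harmonic_iff:
  "classical_harmonic S \<Phi> D \<longleftrightarrow> open S \<and> (\<forall>z\<in>S. GDERIV \<Phi> z :> D z) \<and>
     (\<lambda>z. cnj (D z)) holomorphic_on S \<and>
     continuous_on (closure S) \<Phi> \<and> continuous_on (closure S) D"
  unfolding classical_harmonic_def
  using harmonic_on_cnj_gradient_holomorphic harmonic_on_if_cnj_gradient_holomorphic
  by (metis harmonic_on_def)

section \<open>Holomorphic primitives, the maximum principle and uniqueness of gradients\<close>

lemma GDERIV_Re_primitive:
  assumes "(F has_field_derivative cnj d) (at z)"
  shows "GDERIV (\<lambda>z. Re (F z)) z :> d"
proof -
  have "((\<lambda>z. Re (F z)) has_derivative (\<lambda>v. Re (cnj d * v))) (at z)"
    using assms unfolding has_field_derivative_def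
    by (rule bounded_linear.has_derivative[OF bounded_linear_Re])
  moreover have "(\<lambda>v. Re (cnj d * v)) = (\<lambda>v. v \<bullet> d)"
    by (auto simp: inner_complex_def)
  ultimately show ?thesis by (simp add: gderiv_def)
qed

lemma GDERIV_eq_imp_diff_constant:
  fixes f g :: "complex \<Rightarrow> real"
  assumes "open S" "connected S"
    and "\<And>z. z \<in> S \<Longrightarrow> GDERIV f z :> D z" "\<And>z. z \<in> S \<Longrightarrow> GDERIV g z :> D z"
  obtains c where "\<And>z. z \<in> S \<Longrightarrow> f z = g z + c"
proof (cases "S = {}")
  case False
  then obtain a where a: "a \<in> S" by blast
  have "((\<lambda>z. f z - g z) has_derivative (\<lambda>x. 0)) (at z)" if "z \<in> S" for z
    using GDERIV_diff[OF assms(3)[OF that] assms(4)[OF that]] by (simp add: gderiv_def)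
  then have "f z - g z = f a - g a" if "z \<in> S" for z
    using has_derivative_zero_unique_connected[OF assms(1,2), of "\<lambda>z. f z - g z"] a that by blast
  then show ?thesis by (intro that[of "f a - g a"]) (simp add: algebra_simps)
qed (use that in auto)

text \<open>A starlike set carries a primitive of the holomorphic function \<open>cnj D\<close>. Its
  real part has the same gradient as \<Phi>, so the two differ by a constant, which is subtracted
  from the primitive.\<close>

lemma harmonic_primitive:
  assumes "open S" "starlike S"
    and grad: "\<And>z. z \<in> S \<Longrightarrow> GDERIV \<Phi> z :> D z" and hol: "(\<lambda>z. cnj (D z)) holomorphic_on S"
  obtains F where "\<And>z. z \<in> S \<Longrightarrow> (F has_field_derivative cnj (D z)) (at z)"
    and "\<And>z. z \<in> S \<Longrightarrow> Re (F z) = \<Phi> z"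
proof -
  obtain F where F: "\<forall>z\<in>S. (F has_field_derivative cnj (D z)) (at z)"
    using holomorphic_starlike_primitive[OF holomorphic_on_imp_continuous_on[OF hol] assms(2,1), of "{}"]
      hol assms(1) by (metis finite.emptyI Diff_empty holomorphic_on_imp_differentiable_at)
  obtain c where c: "\<And>z. z \<in> S \<Longrightarrow> Re (F z) = \<Phi> z + c"
    using GDERIV_eq_imp_diff_constant[of S "\<lambda>z. Re (F z)" D \<Phi>] F grad GDERIV_Re_primitive
      assms(1) starlike_imp_connected[OF assms(2)] by metis
  show ?thesis
    by (rule that[of "\<lambda>z. F z - of_real c"]) (use F c in \<open>auto intro!: derivative_eq_intros\<close>)
qed

text \<open>With \<open>Re F = u\<close> the modulus of \<open>exp F\<close> is
  \<open>exp u\<close>. An interior maximum of \<open>u\<close> thus makes \<open>exp F\<close>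
  constant by the maximum modulus principle, hence \<open>u\<close> constant on the closure;
  boundedness supplies a frontier point, where the value is 0.\<close>

lemma harmonic_maximum_principle:
  assumes "bounded S" "starlike S" and u: "classical_harmonic S u D"
    and bd: "\<And>z. z \<in> frontier S \<Longrightarrow> u z = 0" and z: "z \<in> closure S"
  shows "u z \<le> 0"
proof -
  have S: "open S" and grad: "\<And>z. z \<in> S \<Longrightarrow> GDERIV u z :> D z"
    and hol: "(\<lambda>z. cnj (D z)) holomorphic_on S" and cont: "continuous_on (closure S) u"
    using u by (auto simp: classical_harmonic_iff)
  obtain F where F: "\<And>z. z \<in> S \<Longrightarrow> (F has_field_derivative cnj (D z)) (at z)"
    and ReF: "\<And>z. z \<in> S \<Longrightarrow> Re (F z) = u z"
    using harmonic_primitive[OF S assms(2) grad hol] by metis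
  have "compact (closure S)" using assms(1) by simp
  then have "\<exists>a\<in>closure S. \<forall>y\<in>closure S. u y \<le> u a"
    using z by (intro continuous_attains_sup[OF _ _ cont]) auto
  then obtain a where a: "a \<in> closure S" and max: "\<And>y. y \<in> closure S \<Longrightarrow> u y \<le> u a"
    by blast
  have front: "frontier S = closure S - S" using S by (simp add: frontier_def interior_open)
  have "u a = 0"
  proof (cases "a \<in> S")
    case False
    then show ?thesis using a bd front by blast
  next
    case True
    have holE: "(\<lambda>z. exp (F z)) holomorphic_on S"
      using F S by (intro holomorphic_on_exp'[unfolded o_def]) (auto simp: holomorphic_on_open)
    have "(\<lambda>z. exp (F z)) constant_on S"
    proof (rule maximum_modulus_principle[OF holE S _ S order_refl True])
      show "connected S" using assms(2) by (rule starlike_imp_connected)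
      show "cmod (exp (F z)) \<le> cmod (exp (F a))" if "z \<in> S" for z
        using max[of z] that closure_subset ReF True by (auto simp: norm_exp_eq_Re)
    qed
    then obtain c where c: "\<And>z. z \<in> S \<Longrightarrow> exp (F z) = c" by (auto simp: constant_on_def)
    have "u z = u a" if "z \<in> S" for z
      using c[OF that] c[OF True] ReF that True by (metis exp_inj_iff norm_exp_eq_Re)
    then have eq: "u z = u a" if "z \<in> closure S" for z
      using continuous_constant_on_closure[OF cont _ that] by blast
    have "frontier S \<noteq> {}"
      using assms(1) True frontier_eq_empty[of S] not_bounded_UNIV by auto
    then show ?thesis using eq bd front by (metis DiffE ex_in_conv)
  qed
  then show ?thesis using max z by fastforce
qed

lemma classical_harmonic_diff:
  assumes "classical_harmonic S u D" "classical_harmonic S v E"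
  shows "classical_harmonic S (\<lambda>z. u z - v z) (\<lambda>z. D z - E z)"
  using assms unfolding classical_harmonic_iff complex_cnj_diff
  by (intro conjI ballI GDERIV_diff continuous_on_diff holomorphic_on_diff) simp_all

text \<open>The maximum principle for both differences makes \<open>u - v\<close> vanish, so the
  gradients agree inside. The Dirichlet-Neumann operator evaluates the gradient on the frontier,
  which is reached by continuity of the extended gradients.\<close>

lemma classical_harmonic_gradient_unique:
  assumes "bounded S" "starlike S"
    and u: "classical_harmonic S u D" and v: "classical_harmonic S v E"
    and bd: "\<And>z. z \<in> frontier S \<Longrightarrow> u z = v z" and z: "z \<in> closure S"
  shows "D z = E z"
proof -
  note uv = classical_harmonic_diff[OF u v] and vu = classical_harmonic_diff[OF v u]
  have S: "open S" and cont: "continuous_on (closure S) (\<lambda>z. D z - E z)"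
    and grad: "\<And>z. z \<in> S \<Longrightarrow> GDERIV (\<lambda>z. u z - v z) z :> D z - E z"
    using uv by (auto simp: classical_harmonic_iff)
  have eq: "u z - v z = 0" if "z \<in> closure S" for z
    using harmonic_maximum_principle[OF assms(1,2) uv _ that]
      harmonic_maximum_principle[OF assms(1,2) vu _ that] bd by force
  have "D z - E z = 0" if z: "z \<in> S" for z
  proof (rule GDERIV_unique[OF grad[OF z]])
    have "((\<lambda>z. 0) has_derivative (\<lambda>x. 0)) (at z)" by simp
    then have "((\<lambda>z. u z - v z) has_derivative (\<lambda>x. 0)) (at z)"
      by (rule has_derivative_transform_within_open[OF _ S z])
        (use eq closure_subset in force)
    then show "GDERIV (\<lambda>z. u z - v z) z :> 0" by (simp add: gderiv_def)
  qed
  then have "D z - E z = 0"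
    using continuous_constant_on_closure[OF cont _ z] by blast
  then show ?thesis by simp
qed

section \<open>Star-shaped domains in logarithmic coordinates\<close>

lemma open_exp_image: "open U \<Longrightarrow> open (exp ` U :: complex set)"
  using covering_space_open_map[OF covering_space_exp_punctured_plane, of U]
    openin_open_trans[of "- {0}" "exp ` U"] by (simp add: open_Compl)

lemma circle_cis: "x \<in> circle \<longleftrightarrow> (\<exists>\<theta>. x = cis \<theta>)"
proof
  assume "x \<in> circle"
  then have "norm x = 1" by simp
  then have "x = cis (Arg x)" using cis_Arg[of x] by (cases "x = 0") (auto simp: sgn_eq)
  then show "\<exists>\<theta>. x = cis \<theta>" ..
qed auto

locale star_profile =
  fixes h :: "complex \<Rightarrow> real" and \<xi> :: "real \<Rightarrow> real"
  assumes h_gt: "\<And>x. x \<in> circle \<Longrightarrow> h x > - 1"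
    and cont_\<xi>: "continuous_on UNIV \<xi>"
    and \<xi>_eq: "\<And>\<theta>. \<xi> \<theta> = ln (1 + h (cis \<theta>))"
begin

lemma exp_\<xi>: "exp (\<xi> \<theta>) = 1 + h (cis \<theta>)"
  using h_gt[of "cis \<theta>"] by (simp add: \<xi>_eq)

text \<open>Signed distance of \<open>w\<close> from the graph of \<xi>, measured along the real
  direction. It depends on \<open>exp w\<close> only, so membership in the domain, its closure and
  its frontier can be read off from its sign at an arbitrary logarithm.\<close>

definition level :: "complex \<Rightarrow> real" where "level w = Re w - \<xi> (Im w)"

lemma \<xi>_Im_cong: "exp w = exp w' \<Longrightarrow> \<xi> (Im w) = \<xi> (Im w')"
proof -
  assume eq: "exp w = exp w'"
  then have "exp (Re w) = exp (Re w')" by (metis norm_exp_eq_Re)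
  then have "cis (Im w) = cis (Im w')" using eq unfolding exp_eq_polar by simp
  then show ?thesis by (simp add: \<xi>_eq)
qed

lemma level_cong: "exp w = exp w' \<Longrightarrow> level w = level w'"
proof -
  assume eq: "exp w = exp w'"
  then have "exp (Re w) = exp (Re w')" by (metis norm_exp_eq_Re)
  then show ?thesis using \<xi>_Im_cong[OF eq] by (simp add: level_def)
qed

lemma cont_level: "continuous_on UNIV level"
  unfolding level_def by (intro continuous_intros continuous_on_compose2[OF cont_\<xi>]) auto

lemma level_shift: "level (w + of_real s) = level w + s"
  by (simp add: level_def)

lemma half_cyl_eq: "half_cyl \<xi> = {w. level w < 0}"
  by (simp add: half_cyl_def level_def)

lemma open_level: "open {w. level w < 0}" "open {w. level w > 0}" and closed_level: "closed {w. level w \<le> 0}"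
  using cont_level by (auto intro!: open_Collect_less closed_Collect_le continuous_on_const)

lemma \<xi>_bounded: obtains m where "\<And>\<theta>. \<bar>\<xi> \<theta>\<bar> \<le> m"
proof -
  have "compact (\<xi> ` {-pi..pi})"
    by (intro compact_continuous_image continuous_on_subset[OF cont_\<xi>]) auto
  then obtain m where m: "\<And>y. y \<in> \<xi> ` {-pi..pi} \<Longrightarrow> norm y \<le> m"
    by (meson bounded_iff compact_imp_bounded)
  have "\<bar>\<xi> \<theta>\<bar> \<le> m" for \<theta>
  proof -
    have "\<xi> \<theta> = \<xi> (Arg (cis \<theta>))" unfolding \<xi>_eq by (simp add: cis_Arg)
    moreover have "Arg (cis \<theta>) \<in> {-pi..pi}" using Arg_bounded[of "cis \<theta>"] by auto
    ultimately show ?thesis using m by (metis image_eqI real_norm_def)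
  qed
  then show ?thesis using that by blast
qed

section \<open>The domain, its closure and its frontier as images under the exponential\<close>

lemma bdry_cis: "bdry h (cis \<theta>) = exp (Complex (\<xi> \<theta>) \<theta>)"
  unfolding bdry_def exp_eq_polar by (simp add: exp_\<xi> scaleR_conv_of_real)

lemma bdry_image: "bdry h ` circle = exp ` {w. level w = 0}"
proof -
  have "bdry h ` circle = (\<lambda>\<theta>. bdry h (cis \<theta>)) ` UNIV"
    using circle_cis by (auto simp: image_iff)
  also have "\<dots> = exp ` ((\<lambda>\<theta>. Complex (\<xi> \<theta>) \<theta>) ` UNIV)"
    by (auto simp: bdry_cis)
  also have "(\<lambda>\<theta>. Complex (\<xi> \<theta>) \<theta>) ` UNIV = {w. level w = 0}"
    by (auto simp: level_def image_iff complex_eq_iff)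
  finally show ?thesis .
qed

text \<open>An explicit candidate for \<open>star_dom h\<close>, which is given only topologically
  through \<open>inside\<close>; \<open>star_dom_eq\<close> identifies the two. The origin is added
  by hand because \<open>exp\<close> omits it.\<close>

definition dom :: "complex set" where "dom = insert 0 (exp ` {w. level w < 0})"

lemma exp_mem_image: "exp w \<in> exp ` {w. P (level w)} \<longleftrightarrow> P (level w)"
proof
  assume "exp w \<in> exp ` {w. P (level w)}"
  then obtain w' where "exp w = exp w'" "P (level w')" by blast
  then show "P (level w)" using level_cong[of w w'] by simp
qed blast

lemma exp_mem_dom: "exp w \<in> dom \<longleftrightarrow> level w < 0"
  unfolding dom_def using exp_mem_image[of w "\<lambda>x. x < 0"] by simp

lemma exp_mem_zero: "exp w \<in> exp ` {w. level w = 0} \<longleftrightarrow> level w = 0"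
  by (rule exp_mem_image)

lemma open_dom: "open dom"
proof -
  obtain m where m: "\<And>\<theta>. \<bar>\<xi> \<theta>\<bar> \<le> m" using \<xi>_bounded by blast
  \<comment> \<open>The image of the half-cylinder misses the origin, so openness there needs a
    ball. For |z| < exp (-m) every logarithm has real part below -m, hence below \<xi>.\<close>
  have "ball 0 (exp (-m)) \<subseteq> dom"
  proof
    fix z :: complex assume z: "z \<in> ball 0 (exp (-m))"
    show "z \<in> dom"
    proof (cases "z = 0")
      case False
      then have "exp (Re (Ln z)) < exp (-m)" using z by simp
      then have "Re (Ln z) < - m" by (simp only: exp_less_cancel_iff)
      then have "level (Ln z) < 0" using m[of "Im (Ln z)"] by (simp add: level_def)
      then show ?thesis using exp_mem_dom[of "Ln z"] False by simp
    qed (simp add: dom_def)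
  qed
  then have "dom = exp ` {w. level w < 0} \<union> ball 0 (exp (-m))"
    by (auto simp: dom_def)
  then show ?thesis using open_exp_image[OF open_level(1)] by auto
qed

lemma mem_closure_level:
  assumes "level w \<le> 0"
  shows "(\<lambda>n. w - of_real (inverse (real (Suc n)))) \<longlonglongrightarrow> w"
    and "level (w - of_real (inverse (real (Suc n)))) < 0"
proof -
  show "(\<lambda>n. w - of_real (inverse (real (Suc n)))) \<longlonglongrightarrow> w"
    using tendsto_diff[OF tendsto_const[of w] tendsto_of_real[OF LIMSEQ_inverse_real_of_nat]]
    unfolding of_real_0 diff_zero .
  show "level (w - of_real (inverse (real (Suc n)))) < 0"
  proof -
    have "level (w - of_real (inverse (real (Suc n)))) = level w - inverse (real (Suc n))"
      using level_shift[of w "- inverse (real (Suc n))"] by simp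
    also have "\<dots> < 0" using assms inverse_positive_iff_positive[of "real (Suc n)"] by linarith
    finally show ?thesis .
  qed
qed

lemma closure_half_cyl: "closure (half_cyl \<xi>) = {w. level w \<le> 0}"
proof
  show "closure (half_cyl \<xi>) \<subseteq> {w. level w \<le> 0}"
    by (intro closure_minimal closed_level) (auto simp: half_cyl_eq)
  show "{w. level w \<le> 0} \<subseteq> closure (half_cyl \<xi>)"
  proof
    fix w assume "w \<in> {w. level w \<le> 0}"
    then have "level w \<le> 0" by simp
    note w = mem_closure_level[OF this]
    show "w \<in> closure (half_cyl \<xi>)"
      unfolding closure_sequential half_cyl_eq using w
      by (intro exI[of _ "\<lambda>n. w - of_real (inverse (real (Suc n)))"]) blast
  qed
qed

lemma closure_dom: "closure dom = insert 0 (exp ` {w. level w \<le> 0})"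
proof
  \<comment> \<open>Closedness comes from the complement: the image of the open set of positive
    level is open, as \<open>exp\<close> is a covering of the punctured plane.\<close>
  have "insert 0 (exp ` {w. level w \<le> 0}) = - exp ` {w. level w > 0}"
  proof -
    have "z \<in> insert 0 (exp ` {w. level w \<le> 0}) \<longleftrightarrow> z \<in> - exp ` {w. level w > 0}" for z
    proof (cases "z = 0")
      case False
      then have "z = exp (Ln z)" by simp
      moreover have "exp w \<in> exp ` {w. level w \<le> 0} \<longleftrightarrow> \<not> exp w \<in> exp ` {w. level w > 0}" for w
        using exp_mem_image[of w "\<lambda>x. x \<le> 0"] exp_mem_image[of w "\<lambda>x. x > 0"] by (simp add: not_less)
      ultimately show ?thesis using False by (metis Compl_iff insert_iff)
    qed auto
    then show ?thesis by blast
  qed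
  then have "closed (insert 0 (exp ` {w. level w \<le> 0}))"
    using open_exp_image[OF open_level(2)] by (metis closed_Compl)
  then show "closure dom \<subseteq> insert 0 (exp ` {w. level w \<le> 0})"
    by (rule closure_minimal[rotated]) (auto simp: dom_def)
  show "insert 0 (exp ` {w. level w \<le> 0}) \<subseteq> closure dom"
  proof
    fix z assume "z \<in> insert 0 (exp ` {w. level w \<le> 0})"
    then consider "z = 0" | w where "z = exp w" "level w \<le> 0" by blast
    then show "z \<in> closure dom"
    proof cases
      case 1
      then show ?thesis using closure_subset[of dom] by (auto simp: dom_def)
    next
      case 2
      have "(\<lambda>n. exp (w - of_real (inverse (real (Suc n))))) \<longlonglongrightarrow> z"
        unfolding 2(1) by (intro tendsto_intros mem_closure_level(1) 2(2))
      moreover have "exp (w - of_real (inverse (real (Suc n)))) \<in> dom" for n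
        using mem_closure_level(2)[OF 2(2)] exp_mem_dom by blast
      ultimately show ?thesis using closure_sequential[of z dom] by metis
    qed
  qed
qed

lemma exp_mem_closure_dom: "exp w \<in> closure dom \<longleftrightarrow> level w \<le> 0"
  unfolding closure_dom using exp_mem_image[of w "\<lambda>x. x \<le> 0"] by simp

lemma frontier_dom: "frontier dom = bdry h ` circle"
proof -
  have "frontier dom = closure dom - dom" by (simp add: frontier_def interior_open open_dom)
  also have "\<dots> = exp ` {w. level w = 0}"
  proof (intro set_eqI iffI)
    fix z assume "z \<in> closure dom - dom"
    then obtain w where "z = exp w" "level w \<le> 0" "\<not> level w < 0"
      using exp_mem_dom unfolding closure_dom by (auto simp: dom_def)
    then show "z \<in> exp ` {w. level w = 0}" by auto
  next
    fix z assume "z \<in> exp ` {w. level w = 0}"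
    then show "z \<in> closure dom - dom" using exp_mem_dom exp_mem_closure_dom by auto
  qed
  finally show ?thesis by (simp add: bdry_image)
qed

lemma bounded_dom: "bounded dom"
proof -
  obtain m where m: "\<And>\<theta>. \<bar>\<xi> \<theta>\<bar> \<le> m" using \<xi>_bounded by blast
  have "norm z \<le> exp m" if z: "z \<in> dom" for z
  proof (cases "z = 0")
    case False
    then obtain w where w: "z = exp w" "level w < 0" using z False by (auto simp: dom_def)
    then have "Re w \<le> m" using m[of "Im w"] by (simp add: level_def)
    then show ?thesis by (simp add: w)
  qed simp
  then show ?thesis unfolding bounded_iff by blast
qed

text \<open>Scaling by \<open>t\<close> in (0, 1] is translation by \<open>ln t \<le> 0\<close> in
  logarithmic coordinates, which does not raise the level.\<close>

lemma starlike_dom: "starlike dom"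
  unfolding starlike_def
proof (intro bexI ballI subsetI)
  show "0 \<in> dom" by (simp add: dom_def)
  fix z y assume z: "z \<in> dom" and "y \<in> closed_segment 0 z"
  then obtain t where t: "0 \<le> t" "t \<le> 1" "y = t *\<^sub>R z"
    by (auto simp: closed_segment_def)
  show "y \<in> dom"
  proof (cases "t = 0 \<or> z = 0")
    case False
    then obtain w where w: "z = exp w" "level w < 0" using z by (auto simp: dom_def)
    have "y = exp (w + of_real (ln t))"
      using False t by (simp add: w exp_add scaleR_conv_of_real exp_of_real mult.commute)
    moreover have "level (w + of_real (ln t)) < 0"
      using False t w unfolding level_shift by (simp add: add_neg_nonpos)
    ultimately show ?thesis using exp_mem_dom by simp
  qed (use t in \<open>auto simp: dom_def\<close>)
qed

text \<open>A bounded open set lies in the inside of its frontier, which gives one inclusion.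
  Conversely, a point off the curve with positive level can escape to infinity radially without
  meeting the curve, so its component is unbounded.\<close>

lemma star_dom_eq: "star_dom h = dom"
proof
  show "dom \<subseteq> star_dom h"
    using interior_inside_frontier[OF bounded_dom]
    by (simp add: star_dom_def interior_open open_dom frontier_dom)
  show "star_dom h \<subseteq> dom"
  proof
    fix z assume z: "z \<in> star_dom h"
    show "z \<in> dom"
    proof (rule ccontr)
      assume nz: "z \<notin> dom"
      then have "z \<noteq> 0" by (auto simp: dom_def)
      then obtain w where w: "z = exp w" by (metis exp_Ln)
      have zn: "z \<notin> bdry h ` circle" and bd: "bounded (connected_component_set (- (bdry h ` circle)) z)"
        using z by (auto simp: star_dom_def inside_def)
      have lw: "level w > 0"
        using nz zn exp_mem_dom exp_mem_zero unfolding w bdry_image by fastforce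
      \<comment> \<open>The outward radial ray from \<open>z\<close>; the level grows by
        \<open>s\<close> along it and stays positive.\<close>
      define R where "R = (\<lambda>s. exp (w + of_real s)) ` {0..}"
      have "R \<subseteq> connected_component_set (- (bdry h ` circle)) z"
      proof (rule connected_component_maximal)
        show "z \<in> R" unfolding R_def w by (rule image_eqI[of _ _ 0]) auto
        show "connected R" unfolding R_def
          by (intro connected_continuous_image continuous_intros) (auto intro: convex_connected)
        show "R \<subseteq> - (bdry h ` circle)"
        proof -
          have "exp (w + of_real s) \<notin> exp ` {w. level w = 0}" if "s \<ge> 0" for s
            unfolding exp_mem_zero level_shift using lw that by simp
          then show ?thesis unfolding R_def bdry_image by (intro image_subsetI) simp
        qed
      qed
      then have "bounded R" using bd bounded_subset by blast
      then obtain B where B: "\<And>s. s \<ge> 0 \<Longrightarrow> exp (Re w + s) \<le> B"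
        unfolding R_def bounded_iff by (auto simp: norm_exp_eq_Re)
      \<comment> \<open>Chosen so that the exponent reaches the supposed bound \<open>B\<close>,
        while \<open>exp x \<ge> 1 + x\<close> exceeds it.\<close>
      define s where "s = max 0 (B - Re w)"
      have "exp (Re w + s) \<le> B" using B by (simp add: s_def)
      moreover have "exp (Re w + s) \<ge> 1 + (Re w + s)" by (rule exp_ge_add_one_self)
      moreover have "Re w + s \<ge> B" by (simp add: s_def)
      ultimately show False by linarith
    qed
  qed
qed

lemma dirichlet_solution_iff:
  "dirichlet_solution h \<psi> \<Phi> D \<longleftrightarrow> classical_harmonic dom \<Phi> D \<and> (\<forall>x\<in>circle. \<Phi> (bdry h x) = \<psi> x)"
  by (simp add: dirichlet_solution_def star_dom_eq)

lemma dirichlet_gradient_unique: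
  assumes "dirichlet_solution h \<psi> \<Phi> D" "dirichlet_solution h \<psi> \<Phi>' D'" "z \<in> closure dom"
  shows "D z = D' z"
proof (rule classical_harmonic_gradient_unique[OF bounded_dom starlike_dom _ _ _ assms(3)])
  show "\<Phi> z = \<Phi>' z" if "z \<in> frontier dom" for z
    using that assms(1,2) unfolding dirichlet_solution_iff frontier_dom by auto
qed (use assms(1,2) in \<open>auto simp: dirichlet_solution_iff\<close>)

end

section \<open>Transfer between the domain and the half-cylinder\<close>

text \<open>The real adjoint of multiplication by \<open>g'\<close> is multiplication by its
  conjugate, and gradients transform by the adjoint of the derivative.\<close>

lemma GDERIV_compose_holomorphic:
  assumes "GDERIV \<Phi> (g z) :> d" "(g has_field_derivative g') (at z)"
  shows "GDERIV (\<lambda>z. \<Phi> (g z)) z :> cnj g' * d"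
proof -
  have "((\<Phi> \<circ> g) has_derivative ((\<lambda>v. v \<bullet> d) \<circ> (*) g')) (at z)"
    using assms unfolding gderiv_def has_field_derivative_def by (intro diff_chain_at)
  moreover have "(\<lambda>v. v \<bullet> d) \<circ> (*) g' = (\<lambda>v. v \<bullet> (cnj g' * d))"
    by (auto simp: fun_eq_iff inner_complex_def algebra_simps)
  ultimately show ?thesis by (simp add: gderiv_def o_def)
qed

lemma GDERIV_cong_eventually:
  assumes "GDERIV f z :> d" "\<forall>\<^sub>F y in nhds z. f y = g y"
  shows "GDERIV g z :> d"
proof -
  have "\<forall>\<^sub>F y in at z. f y = g y" using assms(2) by (simp add: eventually_nhds_conv_at)
  moreover have "f z = g z" using assms(2) by (rule eventually_nhds_x_imp_x)
  ultimately show ?thesis using assms(1) unfolding gderiv_def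
    by (metis UNIV_I has_derivative_transform_eventually)
qed

lemma GDERIV_partial_Im:
  assumes "GDERIV \<Phi> (Complex \<rho> \<theta>) :> d"
  shows "((\<lambda>t. \<Phi> (Complex \<rho> t)) has_real_derivative Im d) (at \<theta>)"
proof -
  have "((\<lambda>t. Complex \<rho> t) has_derivative (\<lambda>x. x *\<^sub>R \<i>)) (at \<theta>)"
  proof -
    have "((\<lambda>t. of_real \<rho> + t *\<^sub>R \<i>) has_derivative (\<lambda>x. x *\<^sub>R \<i>)) (at \<theta>)"
      by (auto intro!: derivative_eq_intros)
    moreover have "(\<lambda>t. of_real \<rho> + t *\<^sub>R \<i>) = (\<lambda>t. Complex \<rho> t)"
      by (auto simp: complex_eq_iff)
    ultimately show ?thesis by simp
  qed
  then have "((\<Phi> \<circ> (\<lambda>t. Complex \<rho> t)) has_derivative (\<lambda>v. v \<bullet> d) \<circ> (\<lambda>x. x *\<^sub>R \<i>)) (at \<theta>)"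
    using assms unfolding gderiv_def by (intro diff_chain_at)
  moreover have "(\<lambda>v. v \<bullet> d) \<circ> (\<lambda>x. x *\<^sub>R \<i>) = (*) (Im d)"
    by (auto simp: fun_eq_iff inner_complex_def)
  ultimately show ?thesis by (simp add: has_field_derivative_def o_def)
qed

section \<open>Removable singularities and local branches of the logarithm\<close>

lemma continuous_on_insert_isCont:
  assumes "continuous_on (T - {a}) f" "isCont f a"
  shows "continuous_on T f"
  unfolding continuous_on_eq_continuous_within
proof
  fix z assume z: "z \<in> T"
  show "continuous (at z within T) f"
  proof (cases "z = a")
    case True
    then show ?thesis using assms(2) continuous_at_imp_continuous_at_within by blast
  next
    case False
    have "at z within T = at z within (T - {a})"
      by (rule at_within_nhd[of _ "- {a}"]) (use False in auto)
    then show ?thesis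
      using assms(1) z False by (simp add: continuous_on_eq_continuous_within)
  qed
qed

text \<open>The exponential of \<^term>\<open>g\<close> has a removable singularity with a nonzero value, and its
  logarithmic derivative is the derivative of \<^term>\<open>g\<close>; hence \<^term>\<open>g\<close> has a removable singularity.\<close>

lemma holomorphic_limit_if_Re_tendsto_0:
  assumes "open S" "a \<in> S" and hol: "g holomorphic_on (S - {a})"
    and Re0: "((\<lambda>z. Re (g z)) \<longlongrightarrow> 0) (at a)"
  obtains c where "(g \<longlongrightarrow> c) (at a)"
proof -
  define E where "E z = exp (g z)" for z
  have holE: "E holomorphic_on (S - {a})"
    unfolding E_def using hol by (rule holomorphic_on_exp'[unfolded o_def])
  have normE: "((\<lambda>z. norm (E z)) \<longlongrightarrow> 1) (at a)"
    unfolding E_def norm_exp_eq_Re using tendsto_exp[OF Re0] by simp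
  then have "\<forall>\<^sub>F z in at a. norm (E z) < 2"
    by (rule order_tendstoD(2)) simp
  then have "\<exists>B. \<forall>\<^sub>F z in at a. norm (E z) \<le> B"
    by (intro exI[of _ 2]) (auto elim: eventually_mono)
  then obtain E' where E': "E' holomorphic_on S" "\<And>z. z \<in> S - {a} \<Longrightarrow> E' z = E z"
    using holomorphic_on_extend_bounded[OF holE] assms(1,2) by (metis interior_open)
  obtain r where r: "r > 0" "ball a r \<subseteq> S" using assms(1,2) openE by blast
  have "isCont E' a"
    using holomorphic_on_imp_continuous_on[OF E'(1)] assms(2) by (simp add: continuous_on_eq_continuous_at[OF assms(1)])
  then have "((\<lambda>z. norm (E' z)) \<longlongrightarrow> norm (E' a)) (at a)"
    by (simp add: isCont_def tendsto_norm)
  moreover have "((\<lambda>z. norm (E' z)) \<longlongrightarrow> 1) (at a)"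
    by (rule Lim_transform_within_open[OF normE assms(1,2)]) (simp add: E'(2))
  ultimately have "norm (E' a) = 1" by (metis tendsto_unique at_neq_bot)
  \<comment> \<open>Away from \<open>a\<close> the extension is an exponential; at \<open>a\<close>
    its modulus is 1. So it has no zero on the whole ball, and its logarithmic derivative is
    holomorphic there.\<close>
  then have nz: "E' z \<noteq> 0" if "z \<in> ball a r" for z
    using that r E'(2)[of z] by (cases "z = a") (auto simp: E_def)
  have holE': "E' holomorphic_on ball a r" using E'(1) r(2) by (rule holomorphic_on_subset)
  have "(\<lambda>z. deriv E' z / E' z) holomorphic_on ball a r"
    by (intro holomorphic_on_divide holomorphic_deriv holE' open_ball nz)
  then obtain P where P: "\<And>z. z \<in> ball a r \<Longrightarrow>
      (P has_field_derivative deriv E' z / E' z) (at z within ball a r)"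
    using holomorphic_convex_primitive'[OF convex_ball open_ball] by metis
  then have P: "(P has_field_derivative deriv E' z / E' z) (at z)" if "z \<in> ball a r" for z
    using that by (metis at_within_open open_ball)
  let ?B = "ball a r - {a}"
  have oB: "open ?B" by (simp add: open_delete)
  have "((\<lambda>z. g z - P z) has_derivative (\<lambda>x. 0)) (at z)" if z: "z \<in> ?B" for z
  proof -
    have zS: "z \<in> S - {a}" using z r by auto
    have g: "(g has_field_derivative deriv g z) (at z)"
      using hol zS assms(1) by (intro holomorphic_derivI[of g "S - {a}"]) (auto simp: open_delete)
    then have "(E has_field_derivative E z * deriv g z) (at z)"
      unfolding E_def by (rule DERIV_fun_exp)
    then have "(E' has_field_derivative E z * deriv g z) (at z)"
      by (rule has_field_derivative_transform_within_open[OF _ oB z])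
        (use E'(2) r(2) in \<open>auto simp: subset_iff\<close>)
    then have "deriv E' z / E' z = deriv g z"
      using E'(2)[OF zS] by (simp add: DERIV_imp_deriv E_def)
    then have "((\<lambda>z. g z - P z) has_field_derivative 0) (at z)"
      using DERIV_diff[OF g P[of z]] z by simp
    then show ?thesis by (simp add: has_field_derivative_def lambda_zero)
  qed
  moreover have "connected ?B" by (simp add: connected_punctured_ball)
  moreover obtain b where b: "b \<in> ?B"
  proof
    show "a + of_real (r / 2) \<in> ?B" using r(1) by (auto simp: dist_norm)
  qed
  \<comment> \<open>The punctured ball is connected, so \<open>g - P\<close> is one constant on it;
    \<open>P\<close> is continuous at \<open>a\<close>, and therefore \<open>g\<close> has a limit
    there.\<close>
  ultimately have eq: "g z - P z = g b - P b" if "z \<in> ?B" for z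
    using has_derivative_zero_unique_connected[OF oB] that b by blast
  have "isCont P a" using P[of a] r(1) DERIV_isCont by auto
  then have "((\<lambda>z. P z + (g b - P b)) \<longlongrightarrow> P a + (g b - P b)) (at a)"
    by (intro tendsto_intros) (simp add: isCont_def)
  then have "(g \<longlongrightarrow> P a + (g b - P b)) (at a)"
    by (rule Lim_transform_within_open[OF _ open_ball[of a r]])
      (use r(1) eq in \<open>force simp: algebra_simps\<close>)+
  then show ?thesis by (rule that)
qed

lemma tendsto_exp_Re_at_bot: "(exp \<longlongrightarrow> (0::complex)) (filtercomap Re at_bot)"
proof (rule tendsto_norm_zero_cancel)
  show "((\<lambda>w. cmod (exp w)) \<longlongrightarrow> 0) (filtercomap Re at_bot)"
    unfolding norm_exp_eq_Re by (rule filterlim_compose[OF exp_at_bot filterlim_filtercomap])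
qed

text \<open>This branch of the logarithm is centred at \<open>z\<^sub>0\<close>, so it is
  differentiable there even if \<open>z\<^sub>0\<close> lies on the negative real axis, where
  \<open>Ln\<close> jumps.\<close>

lemma Ln_shift_deriv:
  assumes "z\<^sub>0 \<noteq> 0"
  shows "((\<lambda>z. Ln z\<^sub>0 + Ln (z / z\<^sub>0)) has_field_derivative inverse z\<^sub>0) (at z\<^sub>0)"
proof -
  have "(Ln has_field_derivative inverse (z\<^sub>0 / z\<^sub>0)) (at (z\<^sub>0 / z\<^sub>0))"
    by (rule has_field_derivative_Ln) (use assms in simp)
  from DERIV_add[OF DERIV_const[of "Ln z\<^sub>0"] DERIV_chain2[OF this DERIV_cdivide[OF DERIV_ident]]]
  show ?thesis using assms by (simp add: divide_inverse)
qed

section \<open>Pull-back by the exponential and descent by the logarithm\<close>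

context star_profile
begin

text \<open>The chain rule multiplies the gradient by \<open>cnj (exp w)\<close>. As
  \<open>D\<close> is continuous at the origin and \<open>exp w\<close> tends to 0 when
  \<open>Re w\<close> tends to minus infinity, this factor yields the decay.\<close>

lemma cyl_solution_exp:
  assumes sol: "dirichlet_solution h \<psi> \<Phi> D" and chi: "\<And>\<theta>. chi \<theta> = \<psi> (cis \<theta>)"
  shows "cyl_solution \<xi> chi (\<lambda>w. \<Phi> (exp w)) (\<lambda>w. cnj (exp w) * D (exp w))"
  unfolding cyl_solution_def
proof (intro conjI allI impI)
  have grad: "\<And>z. z \<in> dom \<Longrightarrow> GDERIV \<Phi> z :> D z"
    and hol: "(\<lambda>z. cnj (D z)) holomorphic_on dom"
    and cont: "continuous_on (closure dom) \<Phi>" "continuous_on (closure dom) D"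
    and bd: "\<And>x. x \<in> circle \<Longrightarrow> \<Phi> (bdry h x) = \<psi> x"
    using sol by (auto simp: dirichlet_solution_iff classical_harmonic_iff)
  have img: "exp ` half_cyl \<xi> \<subseteq> dom" by (auto simp: half_cyl_eq exp_mem_dom)
  have climg: "exp ` closure (half_cyl \<xi>) \<subseteq> closure dom"
    unfolding closure_half_cyl by (auto simp: exp_mem_closure_dom)
  show "classical_harmonic (half_cyl \<xi>) (\<lambda>w. \<Phi> (exp w)) (\<lambda>w. cnj (exp w) * D (exp w))"
    unfolding classical_harmonic_iff
  proof (intro conjI ballI)
    show "open (half_cyl \<xi>)" unfolding half_cyl_eq by (rule open_level(1))
    show "GDERIV (\<lambda>w. \<Phi> (exp w)) w :> cnj (exp w) * D (exp w)" if "w \<in> half_cyl \<xi>" for w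
      by (intro GDERIV_compose_holomorphic grad DERIV_exp) (use img that in blast)
    have "((\<lambda>z. cnj (D z)) \<circ> exp) holomorphic_on half_cyl \<xi>"
      by (rule holomorphic_on_compose_gen[OF _ hol img]) (intro holomorphic_intros)
    then have "(\<lambda>w. exp w * cnj (D (exp w))) holomorphic_on half_cyl \<xi>"
      unfolding o_def by (intro holomorphic_intros)
    then show "(\<lambda>w. cnj (cnj (exp w) * D (exp w))) holomorphic_on half_cyl \<xi>" by simp
    show "continuous_on (closure (half_cyl \<xi>)) (\<lambda>w. \<Phi> (exp w))"
      by (rule continuous_on_compose2[OF cont(1) _ climg]) (intro continuous_intros)
    have "continuous_on (closure (half_cyl \<xi>)) (\<lambda>w. D (exp w))"
      by (rule continuous_on_compose2[OF cont(2) _ climg]) (intro continuous_intros)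
    then show "continuous_on (closure (half_cyl \<xi>)) (\<lambda>w. cnj (exp w) * D (exp w))"
      by (intro continuous_intros)
  qed
  show "\<Phi> (exp (Complex \<rho> (\<theta> + 2 * pi))) = \<Phi> (exp (Complex \<rho> \<theta>))" for \<rho> \<theta>
    by (simp add: exp_eq_polar flip: cis_mult)
  show "\<Phi> (exp (Complex (\<xi> \<theta>) \<theta>)) = chi \<theta>" for \<theta>
    using bd[of "cis \<theta>"] by (simp add: chi flip: bdry_cis)
  have "0 \<in> dom" by (simp add: dom_def)
  then have "isCont D 0"
    using continuous_on_subset[OF cont(2) closure_subset] by (simp add: continuous_on_eq_continuous_at[OF open_dom])
  then have "((\<lambda>w. D (exp w)) \<longlongrightarrow> D 0) (filtercomap Re at_bot)"
    by (rule isCont_tendsto_compose[OF _ tendsto_exp_Re_at_bot])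
  from tendsto_Re[OF tendsto_mult[OF tendsto_cnj[OF tendsto_exp_Re_at_bot] this]]
  show "((\<lambda>w. Re (cnj (exp w) * D (exp w))) \<longlongrightarrow> 0) (filtercomap Re at_bot)" by simp
qed

text \<open>Equal exponentials differ by an integer multiple of the period. Nonnegative multiples
  follow by induction, negative ones by exchanging \<open>w\<close> and \<open>w'\<close>; the level
  condition persists because the level depends on the exponential only.\<close>

lemma periodic_exp_cong:
  assumes per: "\<And>w. level w \<le> 0 \<Longrightarrow> f (w + 2 * of_real pi * \<i>) = f w"
    and "exp w = exp w'" "level w' \<le> 0"
  shows "f w = f w'"
proof -
  have nat: "f (w + of_real (2 * real n * pi) * \<i>) = f w" if w: "level w \<le> 0" for w n
  proof (induction n)
    case (Suc n)
    let ?v = "w + of_real (2 * real n * pi) * \<i>"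
    have "exp ?v = exp w" unfolding exp_eq by (intro exI[of _ "int n"]) simp
    then have "level ?v \<le> 0" using w level_cong[of ?v w] by simp
    then have "f (?v + 2 * of_real pi * \<i>) = f w" using per Suc by metis
    moreover have "?v + 2 * of_real pi * \<i> = w + of_real (2 * real (Suc n) * pi) * \<i>"
      by (simp add: algebra_simps)
    ultimately show ?case by metis
  qed simp
  have lw: "level w \<le> 0" using level_cong[OF assms(2)] assms(3) by simp
  obtain k :: int where k: "w = w' + of_real (of_int (2 * k) * pi) * \<i>"
    using assms(2) unfolding exp_eq by blast
  show ?thesis
  proof (cases "k \<ge> 0")
    case True
    then have "w = w' + of_real (2 * real (nat k) * pi) * \<i>" using k by simp
    then show ?thesis using nat[OF assms(3)] by simp
  next
    case False
    then have "w' = w + of_real (2 * real (nat (- k)) * pi) * \<i>" using k by simp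
    then show ?thesis using nat[OF lw] by metis
  qed
qed

text \<open>Both arguments of \<open>f\<close> are logarithms of the same \<open>z\<close>, and
  \<open>f\<close> does not distinguish logarithms. Thus \<open>Ln\<close> may be exchanged for the
  local branch at \<open>z\<^sub>0\<close>, which hides the jump of \<open>Ln\<close>.\<close>

lemma eventually_Ln_shift:
  assumes inv: "\<And>w w'. exp w = exp w' \<Longrightarrow> level w' \<le> 0 \<Longrightarrow> f w = f w'" and "z\<^sub>0 \<noteq> 0"
  shows "\<forall>\<^sub>F z in nhds z\<^sub>0. z \<in> closure dom \<longrightarrow> f (Ln z\<^sub>0 + Ln (z / z\<^sub>0)) = f (Ln z)"
proof -
  have "\<forall>\<^sub>F z in nhds z\<^sub>0. z \<noteq> 0"
    using assms(2) by (rule t1_space_nhds)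
  then show ?thesis
  proof eventually_elim
    case (elim z)
    then have "exp (Ln z\<^sub>0 + Ln (z / z\<^sub>0)) = exp (Ln z)" using assms(2) by (simp add: exp_add)
    then show ?case using inv exp_mem_closure_dom[of "Ln z"] elim by auto
  qed
qed

lemma continuous_on_Ln:
  assumes cont: "continuous_on (closure (half_cyl \<xi>)) f"
    and inv: "\<And>w w'. exp w = exp w' \<Longrightarrow> level w' \<le> 0 \<Longrightarrow> f w = f w'"
  shows "continuous_on (closure dom - {0}) (\<lambda>z. f (Ln z))"
  unfolding continuous_on_def
proof
  fix z\<^sub>0 assume z: "z\<^sub>0 \<in> closure dom - {0}"
  let ?g = "\<lambda>z. Ln z\<^sub>0 + Ln (z / z\<^sub>0)"
  let ?T = "closure dom - {0}"
  have lev: "level (?g z) \<le> 0" if "z \<in> ?T" for z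
    using exp_mem_closure_dom[of "?g z"] that z by (simp add: exp_add)
  have "(?g \<longlongrightarrow> Ln z\<^sub>0) (at z\<^sub>0 within ?T)"
    using DERIV_isCont[OF Ln_shift_deriv[of z\<^sub>0]] z
      tendsto_within_subset[of ?g _ z\<^sub>0 UNIV ?T] by (simp add: isCont_def)
  moreover have "\<forall>\<^sub>F z in at z\<^sub>0 within ?T. ?g z \<in> closure (half_cyl \<xi>)"
    unfolding closure_half_cyl using lev by (auto simp: eventually_at_filter)
  moreover have "Ln z\<^sub>0 \<in> closure (half_cyl \<xi>)"
    using lev[OF z] z unfolding closure_half_cyl by simp
  ultimately have "((\<lambda>z. f (?g z)) \<longlongrightarrow> f (Ln z\<^sub>0)) (at z\<^sub>0 within ?T)"
    by (intro continuous_on_tendsto_compose[OF cont])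
  moreover have "\<forall>\<^sub>F z in at z\<^sub>0 within ?T. f (?g z) = f (Ln z)"
    using eventually_Ln_shift[of f z\<^sub>0, OF inv] z
    by (auto simp: eventually_at_filter elim: eventually_mono)
  ultimately show "((\<lambda>z. f (Ln z)) \<longlongrightarrow> f (Ln z\<^sub>0)) (at z\<^sub>0 within ?T)"
    by (rule Lim_transform_eventually)
qed

lemma eventually_Ln_shift_dom:
  assumes inv: "\<And>w w'. exp w = exp w' \<Longrightarrow> level w' \<le> 0 \<Longrightarrow> f w = f w'" and "z\<^sub>0 \<in> dom - {0}"
  shows "\<forall>\<^sub>F z in nhds z\<^sub>0. f (Ln z\<^sub>0 + Ln (z / z\<^sub>0)) = f (Ln z)"
proof -
  have "\<forall>\<^sub>F z in nhds z\<^sub>0. z \<in> dom"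
    using assms(2) open_dom by (intro eventually_nhds_in_open) auto
  moreover have "\<forall>\<^sub>F z in nhds z\<^sub>0. z \<in> closure dom \<longrightarrow> f (Ln z\<^sub>0 + Ln (z / z\<^sub>0)) = f (Ln z)"
    using eventually_Ln_shift[of f z\<^sub>0, OF inv] assms(2) by auto
  ultimately show ?thesis
  proof eventually_elim
    case (elim z)
    then show ?case using closure_subset[of dom] by blast
  qed
qed

text \<open>The second conclusion relates only gradients, since that is all the Dirichlet-Neumann
  operators evaluate. It holds up to the boundary level 0, the place of evaluation.\<close>

lemma dirichlet_solution_Ln:
  assumes sol: "cyl_solution \<xi> chi \<Phi> D" and chi: "\<And>\<theta>. chi \<theta> = \<psi> (cis \<theta>)"
  obtains \<Phi>' D' where "dirichlet_solution h \<psi> \<Phi>' D'"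
    and "\<And>w. level w \<le> 0 \<Longrightarrow> D w = cnj (exp w) * D' (exp w)"
proof -
  let ?H = "half_cyl \<xi>" and ?p = "2 * of_real pi * \<i>"
  have H: "open ?H" and grad: "\<And>w. w \<in> ?H \<Longrightarrow> GDERIV \<Phi> w :> D w"
    and hol: "(\<lambda>w. cnj (D w)) holomorphic_on ?H"
    and cont: "continuous_on (closure ?H) \<Phi>" "continuous_on (closure ?H) D"
    and per0: "\<And>\<rho> \<theta>. \<rho> \<le> \<xi> \<theta> \<Longrightarrow> \<Phi> (Complex \<rho> (\<theta> + 2 * pi)) = \<Phi> (Complex \<rho> \<theta>)"
    and bd: "\<And>\<theta>. \<Phi> (Complex (\<xi> \<theta>) \<theta>) = chi \<theta>"
    and decay: "((\<lambda>w. Re (D w)) \<longlongrightarrow> 0) (filtercomap Re at_bot)"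
    using sol by (auto simp: cyl_solution_def classical_harmonic_iff)
  have level_p: "level (w + ?p) = level w" for w
    by (rule level_cong) (simp add: exp_eq exI[of _ 1])
  have per: "\<Phi> (w + ?p) = \<Phi> w" if "level w \<le> 0" for w
  proof -
    have "w + ?p = Complex (Re w) (Im w + 2 * pi)" by (simp add: complex_eq_iff)
    then show ?thesis using per0[of "Re w" "Im w"] that by (simp add: level_def)
  qed
  \<comment> \<open>The definition imposes periodicity on \<Phi> alone. In the open half-cylinder
    the gradient inherits it by uniqueness of gradients; continuity then carries it to the
    boundary.\<close>
  have perD0: "D (w + ?p) - D w = 0" if "w \<in> ?H" for w
  proof -
    have "((\<lambda>w. w + ?p) has_field_derivative 1) (at w)" by (auto intro!: derivative_eq_intros)
    moreover have "w + ?p \<in> ?H" using that level_p by (simp add: half_cyl_eq)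
    ultimately have "GDERIV (\<lambda>w. \<Phi> (w + ?p)) w :> cnj 1 * D (w + ?p)"
      by (intro GDERIV_compose_holomorphic grad)
    moreover have "\<forall>\<^sub>F y in nhds w. \<Phi> (y + ?p) = \<Phi> y"
      using eventually_nhds_in_open[OF H that] per by (auto simp: half_cyl_eq elim!: eventually_mono)
    ultimately have "GDERIV \<Phi> w :> D (w + ?p)" using GDERIV_cong_eventually by fastforce
    then show ?thesis using GDERIV_unique[OF _ grad[OF that]] by simp
  qed
  have perD: "D (w + ?p) = D w" if "level w \<le> 0" for w
  proof -
    have "continuous_on (closure ?H) (\<lambda>w. D (w + ?p) - D w)"
      by (intro continuous_on_diff cont(2) continuous_on_compose2[OF cont(2)] continuous_intros)
        (auto simp: closure_half_cyl level_p)
    from continuous_constant_on_closure[OF this perD0, of w] that show ?thesis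
      by (simp add: closure_half_cyl)
  qed
  note inv = periodic_exp_cong[of \<Phi>, OF per] and invD = periodic_exp_cong[of D, OF perD]
  \<comment> \<open>In logarithmic coordinates this is the function z (\<Phi>_x - i \<Phi>_y): its
    real part is the derivative in \<rho>, to which the decay condition applies directly, and its
    imaginary part is minus the derivative in \<theta>.\<close>
  define G where "G z = cnj (D (Ln z))" for z
  have Ln_H: "Ln z \<in> ?H" if "z \<in> dom - {0}" for z
    using that exp_mem_dom[of "Ln z"] by (simp add: half_cyl_eq)
  have grad1: "GDERIV (\<lambda>z. \<Phi> (Ln z)) z :> cnj (inverse z) * D (Ln z)" if z: "z \<in> dom - {0}" for z
  proof (rule GDERIV_cong_eventually)
    show "\<forall>\<^sub>F y in nhds z. \<Phi> (Ln z + Ln (y / z)) = \<Phi> (Ln y)"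
      using eventually_Ln_shift_dom[of \<Phi>, OF inv z] .
    have "GDERIV \<Phi> (Ln z + Ln (z / z)) :> D (Ln z)" using grad[OF Ln_H[OF z]] z by simp
    then show "GDERIV (\<lambda>y. \<Phi> (Ln z + Ln (y / z))) z :> cnj (inverse z) * D (Ln z)"
      using z by (intro GDERIV_compose_holomorphic Ln_shift_deriv) auto
  qed
  have open_dom0: "open (dom - {0})" by (simp add: open_dom open_delete)
  have holG: "G holomorphic_on (dom - {0})"
    unfolding holomorphic_on_open[OF open_dom0]
  proof
    fix z assume z: "z \<in> dom - {0}"
    have "((\<lambda>w. cnj (D w)) has_field_derivative deriv (\<lambda>w. cnj (D w)) (Ln z)) (at (Ln z + Ln (z / z)))"
      using holomorphic_derivI[OF hol H Ln_H[OF z]] z by simp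
    from DERIV_chain2[OF this Ln_shift_deriv] z
    obtain f' where "((\<lambda>y. cnj (D (Ln z + Ln (y / z)))) has_field_derivative f') (at z)" by blast
    moreover have "\<forall>\<^sub>F y in nhds z. cnj (D (Ln z + Ln (y / z))) = G y"
      using eventually_Ln_shift_dom[of D, OF invD z] by (auto simp: G_def elim!: eventually_mono)
    then have "((\<lambda>y. cnj (D (Ln z + Ln (y / z)))) has_field_derivative f') (at z) \<longleftrightarrow>
        (G has_field_derivative f') (at z)"
      by (rule DERIV_cong_ev[OF refl _ refl])
    ultimately show "\<exists>f'. (G has_field_derivative f') (at z)" by blast
  qed
  have zero: "0 \<in> dom" by (simp add: dom_def)
  \<comment> \<open>As \<open>Re (Ln z) = ln (norm z)\<close>, approach to the origin is approach to
    the end of the cylinder at any angle. The decay is uniform in \<theta>, so it becomes a full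
    limit at 0.\<close>
  have "filterlim (\<lambda>z. Re (Ln z)) at_bot (at 0)"
  proof -
    have "filterlim (\<lambda>z::complex. ln (norm z)) at_bot (at 0)"
      by (rule filterlim_compose[OF ln_at_0]) (auto simp: filterlim_at intro!: tendsto_eq_intros eventually_at_filter[THEN iffD2])
    then show ?thesis
      by (rule filterlim_cong[THEN iffD1, rotated -1]) (auto simp: eventually_at_filter)
  qed
  then have "filterlim Ln (filtercomap Re at_bot) (at 0)"
    by (simp add: filterlim_filtercomap_iff o_def)
  from filterlim_compose[OF decay this] have Re0: "((\<lambda>z. Re (G z)) \<longlongrightarrow> 0) (at 0)"
    by (simp add: G_def)
  obtain c where c: "(G \<longlongrightarrow> c) (at 0)"
    using holomorphic_limit_if_Re_tendsto_0[OF open_dom zero holG Re0] by blast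
  have "Re c = 0" using tendsto_unique[OF _ tendsto_Re[OF c] Re0] by simp
  moreover have "Im c = 0"
  proof (rule ccontr)
    assume ne: "Im c \<noteq> 0"
    obtain m where m: "\<And>\<theta>. \<bar>\<xi> \<theta>\<bar> \<le> m" using \<xi>_bounded by blast
    have "\<forall>\<^sub>F z in at 0. Im (G z) \<noteq> 0"
      using tendsto_Im[OF c] ne by (rule tendsto_imp_eventually_ne)
    then obtain d where d: "d > 0" "\<And>z. z \<noteq> 0 \<Longrightarrow> norm z < d \<Longrightarrow> Im (G z) \<noteq> 0"
      by (auto simp: eventually_at dist_norm)
    \<comment> \<open>Below \<open>- m\<close> the whole line of constant \<rho> lies in the
      half-cylinder; below \<open>ln d\<close> its image is a circle of radius less than
      \<open>d\<close>.\<close>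
    define \<rho> where "\<rho> = min (- m) (ln d) - 1"
    have in_H: "Complex \<rho> \<theta> \<in> ?H" for \<theta>
      using m[of \<theta>] by (auto simp: half_cyl_def \<rho>_def)
    have der: "((\<lambda>t. \<Phi> (Complex \<rho> t)) has_real_derivative Im (D (Complex \<rho> \<theta>))) (at \<theta>)" for \<theta>
      by (intro GDERIV_partial_Im grad in_H)
    obtain \<theta> where "\<Phi> (Complex \<rho> (2 * pi)) - \<Phi> (Complex \<rho> 0) = (2 * pi - 0) * Im (D (Complex \<rho> \<theta>))"
      using MVT2[of 0 "2 * pi", OF _ der] by auto
    moreover have "\<Phi> (Complex \<rho> (2 * pi)) = \<Phi> (Complex \<rho> 0)"
      using per0[of \<rho> 0] in_H[of 0] by (simp add: half_cyl_def)
    ultimately have "Im (D (Complex \<rho> \<theta>)) = 0" by simp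
    moreover have "D (Ln (exp (Complex \<rho> \<theta>))) = D (Complex \<rho> \<theta>)"
      using in_H[of \<theta>] by (intro invD) (auto simp: half_cyl_eq)
    moreover have "norm (exp (Complex \<rho> \<theta>)) < d"
    proof -
      have "exp \<rho> < exp (ln d)" by (simp add: \<rho>_def)
      then show ?thesis using d(1) by (simp add: norm_exp_eq_Re)
    qed
    ultimately show False using d(2)[of "exp (Complex \<rho> \<theta>)"] by (simp add: G_def)
  qed
  ultimately have "c = 0" by (simp add: complex_eq_iff)
  \<comment> \<open>The criterion for extending \<open>G z / z\<close> across 0 is that its product
    with \<open>z\<close> tends to 0; this is exactly the limit of \<open>G\<close>.\<close>
  then have "((\<lambda>z. (z - 0) * (G z / z)) \<longlongrightarrow> 0) (at 0)"
    using c by (auto intro: Lim_transform_eventually simp: eventually_at_filter)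
  moreover have "(\<lambda>z. G z / z) holomorphic_on (dom - {0})"
    by (intro holomorphic_intros holG) auto
  ultimately obtain f where f: "f holomorphic_on dom" "\<And>z. z \<in> dom - {0} \<Longrightarrow> f z = G z / z"
    using holomorphic_on_extend_lim[of "\<lambda>z. G z / z" dom 0] open_dom zero by (auto simp: interior_open)
  define D' where "D' z = (if z = 0 then cnj (f 0) else cnj (inverse z) * D (Ln z))" for z
  have cnjD': "cnj (D' z) = f z" if "z \<in> dom" for z
    using that f(2)[of z] by (auto simp: D'_def G_def field_simps)
  obtain r where r: "r > 0" "ball 0 r \<subseteq> dom" using open_dom zero openE by blast
  obtain P where P: "\<And>z. z \<in> ball 0 r \<Longrightarrow> (P has_field_derivative f z) (at z within ball 0 r)"
    using holomorphic_convex_primitive'[OF convex_ball open_ball, of f] f(1) r(2)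
      holomorphic_on_subset by metis
  have P: "GDERIV (\<lambda>z. Re (P z)) z :> D' z" if "z \<in> ball 0 r" for z
  proof (rule GDERIV_Re_primitive)
    show "(P has_field_derivative cnj (D' z)) (at z)"
      using P[OF that] cnjD'[of z] that r(2) by (auto simp: at_within_open[OF _ open_ball])
  qed
  have grad1': "GDERIV (\<lambda>z. \<Phi> (Ln z)) z :> D' z" if "z \<in> dom - {0}" for z
    using grad1[OF that] that by (simp add: D'_def)
  \<comment> \<open>The extended gradient alone does not yet provide a value of the potential at 0.
    Near 0 the real part of a primitive of \<open>f\<close> has gradient \<open>D'\<close>, and on
    the connected punctured ball it differs from the descended \<Phi> by a constant; the missing
    value is read off there.\<close>
  obtain k where k: "\<And>z. z \<in> ball 0 r - {0} \<Longrightarrow> \<Phi> (Ln z) = Re (P z) + k"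
  proof (rule GDERIV_eq_imp_diff_constant[of "ball 0 r - {0}" "\<lambda>z. \<Phi> (Ln z)" D' "\<lambda>z. Re (P z)"])
    show "open (ball 0 r - {0::complex})" by (simp add: open_delete)
    show "connected (ball 0 r - {0::complex})" by (simp add: connected_punctured_ball)
  qed (use grad1' P r(2) in auto)
  define \<Phi>' where "\<Phi>' z = (if z = 0 then Re (P 0) + k else \<Phi> (Ln z))" for z
  have \<Phi>'_ball: "Re (P z) + k = \<Phi>' z" if "z \<in> ball 0 r" for z
    using that k by (auto simp: \<Phi>'_def)
  have grad': "GDERIV \<Phi>' z :> D' z" if "z \<in> dom" for z
  proof (cases "z = 0")
    case True
    have "GDERIV (\<lambda>z. Re (P z) + k) 0 :> D' 0 + 0"
      using r(1) by (intro GDERIV_add P GDERIV_const) auto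
    moreover have "\<forall>\<^sub>F y in nhds 0. Re (P y) + k = \<Phi>' y"
      using eventually_nhds_in_open[of "ball 0 r" 0] r(1) \<Phi>'_ball by (auto elim!: eventually_mono)
    ultimately show ?thesis unfolding True using GDERIV_cong_eventually by fastforce
  next
    case False
    have "\<forall>\<^sub>F y in nhds z. \<Phi> (Ln y) = \<Phi>' y"
      using t1_space_nhds[OF False] by (rule eventually_mono) (simp add: \<Phi>'_def)
    then show ?thesis using GDERIV_cong_eventually grad1' False that by blast
  qed
  have holD': "(\<lambda>z. cnj (D' z)) holomorphic_on dom"
    using f(1) by (rule holomorphic_transform) (simp add: cnjD')
  have "continuous_on (closure dom) \<Phi>'"
  proof (rule continuous_on_insert_isCont)
    show "continuous_on (closure dom - {0}) \<Phi>'"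
      using continuous_on_Ln[OF cont(1) inv] by (rule continuous_on_eq) (auto simp: \<Phi>'_def)
    show "isCont \<Phi>' 0"
      using grad'[OF zero] has_derivative_continuous unfolding gderiv_def by blast
  qed
  moreover have "continuous_on (closure dom) D'"
  proof (rule continuous_on_insert_isCont)
    have "continuous_on (closure dom - {0}) (\<lambda>z. cnj (inverse z) * D (Ln z))"
      by (intro continuous_intros continuous_on_Ln[OF cont(2) invD]) auto
    then show "continuous_on (closure dom - {0}) D'"
      by (rule continuous_on_eq) (auto simp: D'_def)
    have "isCont (\<lambda>z. cnj (D' z)) 0"
      using holomorphic_on_imp_continuous_on[OF holD'] zero by (simp add: continuous_on_eq_continuous_at[OF open_dom])
    then have "isCont (\<lambda>z. cnj (cnj (D' z))) 0" by (rule isCont_cnj)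
    then show "isCont D' 0" by simp
  qed
  ultimately have "classical_harmonic dom \<Phi>' D'"
    unfolding classical_harmonic_iff using open_dom grad' holD' by blast
  moreover have "\<Phi>' (bdry h x) = \<psi> x" if xc: "x \<in> circle" for x
  proof -
    obtain \<theta> where x: "x = cis \<theta>" using xc circle_cis by blast
    have "\<Phi> (Ln (exp (Complex (\<xi> \<theta>) \<theta>))) = \<Phi> (Complex (\<xi> \<theta>) \<theta>)"
      by (rule inv) (simp_all add: level_def)
    then show ?thesis by (simp add: x bdry_cis \<Phi>'_def bd chi)
  qed
  ultimately have "dirichlet_solution h \<psi> \<Phi>' D'" by (simp add: dirichlet_solution_iff)
  moreover have "D w = cnj (exp w) * D' (exp w)" if "level w \<le> 0" for w
  proof -
    have "D (Ln (exp w)) = D w" by (rule invD) (use that in auto)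
    then show ?thesis by (simp add: D'_def)
  qed
  ultimately show ?thesis by (rule that)
qed

text \<open>Whichever gradient \<open>SOME\<close> selects on the half-cylinder descends to a
  gradient of a Dirichlet solution in the domain, and there it must agree with \<open>D\<close> up
  to the boundary.\<close>

lemma DN_cyl_eq:
  assumes sol: "dirichlet_solution h \<psi> \<Phi> D" and chi: "\<And>\<theta>. chi \<theta> = \<psi> (cis \<theta>)"
  shows "DN_cyl \<xi> chi \<theta> = (let g = cnj (bdry h (cis \<theta>)) * D (bdry h (cis \<theta>)) in Re g - deriv \<xi> \<theta> * Im g)"
proof -
  have ex: "\<exists>D \<Phi>. cyl_solution \<xi> chi \<Phi> D" using cyl_solution_exp[OF sol chi] by blast
  define E where "E = (SOME D. \<exists>\<Phi>. cyl_solution \<xi> chi \<Phi> D)"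
  have "\<exists>\<Phi>. cyl_solution \<xi> chi \<Phi> E" unfolding E_def using ex by (rule someI_ex)
  then obtain \<Phi>c where "cyl_solution \<xi> chi \<Phi>c E" by blast
  then obtain \<Phi>' D' where D': "dirichlet_solution h \<psi> \<Phi>' D'"
    "\<And>w. level w \<le> 0 \<Longrightarrow> E w = cnj (exp w) * D' (exp w)"
    using dirichlet_solution_Ln chi by metis
  have "level (Complex (\<xi> \<theta>) \<theta>) = 0" by (simp add: level_def)
  then have "E (Complex (\<xi> \<theta>) \<theta>) = cnj (bdry h (cis \<theta>)) * D (bdry h (cis \<theta>))"
    using D'(2)[of "Complex (\<xi> \<theta>) \<theta>"] dirichlet_gradient_unique[OF D'(1) sol, of "exp (Complex (\<xi> \<theta>) \<theta>)"]
    by (simp add: bdry_cis exp_mem_closure_dom)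
  then show ?thesis using ex unfolding DN_cyl_def E_def[symmetric] by (auto simp: Let_def)
qed

text \<open>Descent in contrapositive form: without a solution in the domain there is none on the
  half-cylinder, so both operators take their default value.\<close>

lemma DN_cyl_eq_0:
  assumes "\<nexists>\<Phi> D. dirichlet_solution h \<psi> \<Phi> D" and chi: "\<And>\<theta>. chi \<theta> = \<psi> (cis \<theta>)"
  shows "DN_cyl \<xi> chi \<theta> = 0"
proof -
  have "\<nexists>\<Phi> D. cyl_solution \<xi> chi \<Phi> D" using dirichlet_solution_Ln chi assms(1) by metis
  then show ?thesis by (simp add: DN_cyl_def)
qed

lemma DN_eq:
  assumes sol: "dirichlet_solution h \<psi> \<Phi> D" and "x \<in> circle"
  shows "DN h \<psi> x = D (bdry h x) \<bullet> outer_normal h x"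
proof -
  have ex: "\<exists>D \<Phi>. dirichlet_solution h \<psi> \<Phi> D" using sol by blast
  define E where "E = (SOME D. \<exists>\<Phi>. dirichlet_solution h \<psi> \<Phi> D)"
  have "\<exists>\<Phi>. dirichlet_solution h \<psi> \<Phi> E" unfolding E_def using ex by (rule someI_ex)
  then obtain \<Phi>' where "dirichlet_solution h \<psi> \<Phi>' E" by blast
  moreover have "bdry h x \<in> closure dom"
    using assms(2) frontier_dom by (auto simp: frontier_def)
  ultimately have "E (bdry h x) = D (bdry h x)" using dirichlet_gradient_unique sol by blast
  then show ?thesis using ex unfolding DN_def E_def[symmetric] by auto
qed

end

section \<open>Tangential gradient, normal and curvature\<close>

text \<open>\<open>\<theta> + Im (Ln (y / cis \<theta>))\<close> is an angle of \<open>y\<close>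
  that is smooth near \<open>cis \<theta>\<close> in the plane; it serves as a local inverse of
  \<open>cis\<close>.\<close>

lemma cis_Im_Ln_circle:
  assumes "y \<in> circle"
  shows "cis (\<theta> + Im (Ln (y / cis \<theta>))) = y"
proof -
  have u: "norm (y / cis \<theta>) = 1" using assms by (simp add: norm_divide)
  then have "y / cis \<theta> \<noteq> 0" by auto
  then have "y / cis \<theta> = of_real (exp (Re (Ln (y / cis \<theta>)))) * cis (Im (Ln (y / cis \<theta>)))"
    by (metis exp_Ln exp_eq_polar)
  also have "Re (Ln (y / cis \<theta>)) = 0" using u \<open>y / cis \<theta> \<noteq> 0\<close> by simp
  finally show ?thesis by (simp add: field_simps flip: cis_mult)
qed

text \<open>Composing \<open>f \<circ> cis\<close> with the local angle function extends
  \<open>f\<close> from the circle to a function differentiable at the point, and its derivative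
  restricts to the circle. Conversely, composing a derivative within the circle with
  \<open>cis\<close> fixes the tangential component of \<open>v\<close>, while the radial one is 0
  by definition.\<close>

lemma tgrad_cis:
  assumes "((\<lambda>t. f (cis t)) has_real_derivative d) (at \<theta>)"
  shows "tgrad f (cis \<theta>) = of_real d * (\<i> * cis \<theta>)"
  unfolding tgrad_def
proof (rule the_equality)
  let ?x = "cis \<theta>" and ?v = "of_real d * (\<i> * cis \<theta>)"
  let ?g = "\<lambda>y. \<theta> + Im (Ln (y / cis \<theta>))"
  have "((\<lambda>y. Ln (y / ?x)) has_field_derivative inverse ?x) (at ?x)"
    by (auto intro!: derivative_eq_intros simp: field_simps)
  then have "(?g has_derivative (\<lambda>w. Im (inverse ?x * w))) (at ?x)"
    unfolding has_field_derivative_def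
    by (auto intro!: derivative_eq_intros bounded_linear.has_derivative[OF bounded_linear_Im])
  moreover have "((\<lambda>t. f (cis t)) has_derivative (*) d) (at (?g ?x))"
    using assms by (simp add: has_field_derivative_def)
  ultimately have "(((\<lambda>t. f (cis t)) \<circ> ?g) has_derivative ((*) d \<circ> (\<lambda>w. Im (inverse ?x * w)))) (at ?x)"
    by (rule diff_chain_at)
  moreover have "(*) d \<circ> (\<lambda>w. Im (inverse ?x * w)) = (\<lambda>w. ?v \<bullet> w)"
    by (auto simp: fun_eq_iff cis_inverse inner_complex_def algebra_simps)
  ultimately have "((\<lambda>y. f (cis (?g y))) has_derivative (\<lambda>w. ?v \<bullet> w)) (at ?x within circle)"
    by (simp add: o_def has_derivative_at_withinI)
  then have "(f has_derivative (\<lambda>w. ?v \<bullet> w)) (at ?x within circle)"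
    by (rule has_derivative_transform[rotated 2]) (auto simp: cis_Im_Ln_circle)
  moreover have "?v \<bullet> ?x = 0" by (simp add: inner_complex_def)
  ultimately show "?v \<bullet> ?x = 0 \<and> (f has_derivative (\<lambda>w. ?v \<bullet> w)) (at ?x within circle)" by blast
  fix v assume v: "v \<bullet> ?x = 0 \<and> (f has_derivative (\<lambda>w. v \<bullet> w)) (at ?x within circle)"
  have "(cis has_derivative (\<lambda>s. of_real s * (\<i> * ?x))) (at \<theta> within UNIV)"
    using has_derivative_cis[of "\<lambda>t. t" "\<lambda>t. t" \<theta>]
    by (simp add: scaleR_conv_of_real)
  from has_derivative_in_compose[OF this has_derivative_subset[of f "\<lambda>w. v \<bullet> w" ?x circle "range cis"]]
  have "((\<lambda>t. f (cis t)) has_derivative (\<lambda>s. v \<bullet> (of_real s * (\<i> * ?x)))) (at \<theta>)"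
    using v by force
  moreover have "(\<lambda>s. v \<bullet> (of_real s * (\<i> * ?x))) = (*) (v \<bullet> (\<i> * ?x))"
    by (auto simp: fun_eq_iff inner_complex_def algebra_simps)
  ultimately have "((\<lambda>t. f (cis t)) has_real_derivative (v \<bullet> (\<i> * ?x))) (at \<theta>)"
    by (simp only: has_field_derivative_def)
  then have "v \<bullet> (\<i> * ?x) = d" using assms by (rule DERIV_unique)
  \<comment> \<open>These are the components of \<open>v\<close> along the orthonormal vectors
    \<open>cis \<theta>\<close> and \<open>\<i> * cis \<theta>\<close>; solving for
    \<open>Re v\<close> and \<open>Im v\<close> rotates them back.\<close>
  with v have 1: "Re v * cos \<theta> + Im v * sin \<theta> = 0" and 2: "Im v * cos \<theta> - Re v * sin \<theta> = d"
    by (auto simp: inner_complex_def)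
  have sc: "sin \<theta> * sin \<theta> = 1 - cos \<theta> * cos \<theta>" using sin_cos_squared_add3[of \<theta>] by linarith
  have "Re v = - (d * sin \<theta>)"
    using 1 2 sc by algebra
  moreover have "Im v = d * cos \<theta>"
    using 1 2 sc by algebra
  ultimately show "v = ?v" by (simp add: complex_eq_iff)
qed

lemma Mop_cis:
  assumes "((\<lambda>t. f (cis t)) has_real_derivative d) (at \<theta>)"
  shows "Mop f (cis \<theta>) = d"
  by (simp add: Mop_def tgrad_cis[OF assms] rotJ_def inner_complex_def algebra_simps)
    (metis distrib_left mult.right_neutral sin_cos_squared_add3)

lemma norm_of_real_cis: "norm (of_real d * (\<i> * cis \<theta>)) = \<bar>d\<bar>"
  by (simp add: norm_mult)

text \<open>With no component along \<open>\<i> * e\<close>, the vector \<open>n\<close> equals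
  \<open>(n \<bullet> e) e\<close>, and the norms force the coefficient to be 1 or -1.\<close>

lemma orthogonal_unit_cases:
  fixes n e :: complex
  assumes "norm n = 1" "norm e = 1" "n \<bullet> (\<i> * e) = 0"
  shows "n = e \<or> n = - e"
proof -
  have e: "Re e * Re e + Im e * Im e = 1" and n: "Re n * Re n + Im n * Im n = 1"
    using assms(1,2) by (auto simp: cmod_def power2_eq_square)
  have o: "Im n * Re e = Re n * Im e" using assms(3) by (simp add: inner_complex_def)
  define c where "c = n \<bullet> e"
  have c: "c = Re n * Re e + Im n * Im e" by (simp add: c_def inner_complex_def)
  have "Re n = c * Re e" unfolding c using e o by algebra
  moreover have "Im n = c * Im e" unfolding c using e o by algebra
  moreover from this \<open>Re n = _\<close> have "c * c = 1" using n e by algebra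
  then have "c = 1 \<or> c = -1" by (simp add: square_eq_1_iff)
  ultimately show ?thesis by (auto simp: complex_eq_iff)
qed

section \<open>Normal vector and curvature of the boundary curve\<close>

locale smooth_star_profile = star_profile +
  assumes \<xi>_deriv: "(\<xi> has_real_derivative deriv \<xi> \<theta>) (at \<theta>)"
    and \<xi>_deriv2: "(deriv \<xi> has_real_derivative deriv (deriv \<xi>) \<theta>) (at \<theta>)"
begin

text \<open>The tangent is \<open>Complex \<xi>' 1\<close> times
  \<open>exp (Complex \<xi> \<theta>)\<close>; multiplying by -i turns it clockwise, and dividing by
  the speed e^\<xi> sqrt (1 + \<xi>'^2) gives this formula.\<close>

definition unit_normal :: "real \<Rightarrow> complex" where
  "unit_normal \<theta> = Complex 1 (- deriv \<xi> \<theta>) / of_real (sqrt (1 + (deriv \<xi> \<theta>)\<^sup>2)) * cis \<theta>"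

lemma bdry_curve_cis: "bdry_curve h (cis \<theta>) s = exp (Complex (\<xi> (\<theta> + s)) (\<theta> + s))"
  by (simp add: bdry_curve_def cis_mult bdry_cis)

lemma bdry_curve_deriv:
  "(bdry_curve h (cis \<theta>) has_vector_derivative
     Complex (deriv \<xi> (\<theta> + s)) 1 * exp (Complex (\<xi> (\<theta> + s)) (\<theta> + s))) (at s)"
proof -
  have "((\<lambda>s. \<xi> (\<theta> + s)) has_real_derivative deriv \<xi> (\<theta> + s)) (at s)"
    using \<xi>_deriv[of "\<theta> + s"] DERIV_shift[of \<xi> _ s \<theta>] by (simp add: add.commute)
  then have "((\<lambda>s. Complex (\<xi> (\<theta> + s)) (\<theta> + s)) has_vector_derivative Complex (deriv \<xi> (\<theta> + s)) 1) (at s)"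
    by (auto simp: has_vector_derivative_complex_iff intro!: derivative_eq_intros)
  from field_vector_diff_chain_at[OF this DERIV_exp]
  show ?thesis by (simp add: o_def bdry_curve_cis[abs_def] mult.commute)
qed

lemma norm_unit_normal: "norm (unit_normal \<theta>) = 1"
proof -
  have pos: "1 + (deriv \<xi> \<theta>)\<^sup>2 > 0" by (simp add: add_pos_nonneg)
  have "norm (Complex 1 (- deriv \<xi> \<theta>)) = sqrt (1 + (deriv \<xi> \<theta>)\<^sup>2)" by (simp add: cmod_def)
  then show ?thesis unfolding unit_normal_def norm_mult norm_divide using pos by simp
qed

lemma tangent_eq_unit_normal:
  "Complex (deriv \<xi> \<theta>) 1 * exp (Complex (\<xi> \<theta>) \<theta>) =
     of_real (exp (\<xi> \<theta>) * sqrt (1 + (deriv \<xi> \<theta>)\<^sup>2)) * (\<i> * unit_normal \<theta>)"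
proof -
  have "1 + (deriv \<xi> \<theta>)\<^sup>2 > 0" by (simp add: add_pos_nonneg)
  then have "complex_of_real (sqrt (1 + (deriv \<xi> \<theta>)\<^sup>2)) \<noteq> 0" by simp
  then show ?thesis unfolding unit_normal_def exp_eq_polar
    by (simp add: complex_eq_iff algebra_simps)
qed

text \<open>In logarithmic coordinates the normal line is \<open>w\<^sub>0 + Ln (1 + s q)\<close>,
  and its level vanishes at \<open>s = 0\<close> with derivative e^(-\<xi>) sqrt (1 + \<xi>'^2) > 0.
  Both sides are recorded: the outer one confirms the normal, the inner one rules out its
  negative.\<close>

lemma dom_along_normal:
  obtains d where "d > 0"
    and "\<And>s. 0 < s \<Longrightarrow> s < d \<Longrightarrow> bdry h (cis \<theta>) + s *\<^sub>R unit_normal \<theta> \<notin> dom"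
    and "\<And>s. 0 < s \<Longrightarrow> s < d \<Longrightarrow> bdry h (cis \<theta>) - s *\<^sub>R unit_normal \<theta> \<in> dom"
proof -
  define w\<^sub>0 where "w\<^sub>0 = Complex (\<xi> \<theta>) \<theta>"
  define q where "q = unit_normal \<theta> / exp w\<^sub>0"
  define S where "S = sqrt (1 + (deriv \<xi> \<theta>)\<^sup>2)"
  have pos: "1 + (deriv \<xi> \<theta>)\<^sup>2 > 0" by (simp add: add_pos_nonneg)
  have S: "S > 0" "S * S = 1 + (deriv \<xi> \<theta>)\<^sup>2" using pos by (auto simp: S_def)
  define g where "g s = level (w\<^sub>0 + Ln (1 + of_real s * q))" for s
  have q: "q = Complex (exp (- \<xi> \<theta>) / S) (- exp (- \<xi> \<theta>) * deriv \<xi> \<theta> / S)"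
    unfolding q_def w\<^sub>0_def unit_normal_def exp_eq_polar S_def[symmetric]
    using S(1) by (simp add: complex_eq_iff exp_minus field_simps)
      (metis add_0 mult_zero_left sin_cos_squared_add3 zero_neq_one)
  have "((\<lambda>s. Ln (1 + of_real s * q)) has_vector_derivative q) (at 0)"
  proof -
    have "((\<lambda>z. Ln (1 + z * q)) has_field_derivative q) (at (of_real 0))"
      by (auto intro!: derivative_eq_intros)
    from has_vector_derivative_real_field[OF this] show ?thesis by simp
  qed
  then have Re: "((\<lambda>s. Re (Ln (1 + of_real s * q))) has_real_derivative Re q) (at 0)"
    and Im: "((\<lambda>s. Im (Ln (1 + of_real s * q))) has_real_derivative Im q) (at 0)"
    by (auto simp: has_vector_derivative_complex_iff)
  have Im': "((\<lambda>s. \<theta> + Im (Ln (1 + of_real s * q))) has_real_derivative Im q) (at 0)"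
    using DERIV_add[OF DERIV_const[of \<theta>] Im] by simp
  have "((\<lambda>s. \<xi> (\<theta> + Im (Ln (1 + of_real s * q)))) has_real_derivative deriv \<xi> \<theta> * Im q) (at 0)"
    by (rule DERIV_chain2[OF _ Im']) (simp add: \<xi>_deriv)
  then have "(g has_real_derivative Re q - deriv \<xi> \<theta> * Im q) (at 0)"
    using DERIV_diff[OF DERIV_add[OF DERIV_const[of "\<xi> \<theta>"] Re]]
    by (simp add: g_def[abs_def] level_def w\<^sub>0_def)
  moreover have "Re q - deriv \<xi> \<theta> * Im q = exp (- \<xi> \<theta>) * (1 + (deriv \<xi> \<theta>)\<^sup>2) / S"
    by (simp add: q power2_eq_square algebra_simps add_divide_distrib)
  then have "Re q - deriv \<xi> \<theta> * Im q > 0" using pos S(1) by simp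
  ultimately obtain d1 d2 where d1: "d1 > 0" "\<And>s. 0 < s \<Longrightarrow> s < d1 \<Longrightarrow> g 0 < g s"
    and d2: "d2 > 0" "\<And>s. 0 < s \<Longrightarrow> s < d2 \<Longrightarrow> g (- s) < g 0"
    using DERIV_pos_inc_right[of g _ 0] DERIV_pos_inc_left[of g _ 0] by (metis add_0 diff_0)
  have g0: "g 0 = 0" by (simp add: g_def level_def w\<^sub>0_def)
  \<comment> \<open>As \<open>q\<close> has modulus \<open>exp (- \<xi> \<theta>)\<close>, the first
    bound keeps \<open>s q\<close> inside the unit disc, so that \<open>1 + s q\<close> is nonzero
    and \<open>exp\<close> undoes \<open>Ln\<close>.\<close>
  define d where "d = min (exp (\<xi> \<theta>)) (min d1 d2)"
  have exp: "exp (w\<^sub>0 + Ln (1 + of_real s * q)) = bdry h (cis \<theta>) + s *\<^sub>R unit_normal \<theta>"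
    if "\<bar>s\<bar> < d" for s
  proof -
    have z: "bdry h (cis \<theta>) + s *\<^sub>R unit_normal \<theta> = exp w\<^sub>0 * (1 + of_real s * q)"
      by (simp add: bdry_cis w\<^sub>0_def[symmetric] q_def scaleR_conv_of_real field_simps)
    have "norm (of_real s * q) < 1"
      using that by (simp add: q_def norm_mult norm_divide norm_unit_normal w\<^sub>0_def d_def)
    then have "1 + of_real s * q \<noteq> 0"
      by (metis add_eq_0_iff less_irrefl norm_minus_cancel norm_one)
    then show ?thesis unfolding z by (simp add: exp_add)
  qed
  show ?thesis
  proof (rule that[of d])
    show "d > 0" using d1 d2 by (simp add: d_def)
    fix s assume s: "0 < s" "s < d"
    then have "g s > 0" "g (- s) < 0" using d1(2)[of s] d2(2)[of s] g0 by (auto simp: d_def)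
    then show "bdry h (cis \<theta>) + s *\<^sub>R unit_normal \<theta> \<notin> dom"
      and "bdry h (cis \<theta>) - s *\<^sub>R unit_normal \<theta> \<in> dom"
      using exp[of s] exp[of "- s"] s exp_mem_dom[of "w\<^sub>0 + Ln (1 + of_real s * q)"]
        exp_mem_dom[of "w\<^sub>0 + Ln (1 + of_real (- s) * q)"]
      by (auto simp: g_def)
  qed
qed

lemma outer_normal_cis: "outer_normal h (cis \<theta>) = unit_normal \<theta>"
  unfolding outer_normal_def star_dom_eq
proof (rule the_equality)
  let ?n = "unit_normal \<theta>" and ?z = "bdry h (cis \<theta>)"
  define c where "c = exp (\<xi> \<theta>) * sqrt (1 + (deriv \<xi> \<theta>)\<^sup>2)"
  have "1 + (deriv \<xi> \<theta>)\<^sup>2 > 0" by (simp add: add_pos_nonneg)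
  then have c: "c > 0" by (simp add: c_def)
  have T: "vector_derivative (bdry_curve h (cis \<theta>)) (at 0) = c *\<^sub>R (\<i> * ?n)"
    using vector_derivative_at[OF bdry_curve_deriv[of \<theta> 0]] tangent_eq_unit_normal[of \<theta>]
    by (simp add: c_def scaleR_conv_of_real)
  obtain d where d: "d > 0" "\<And>s. 0 < s \<Longrightarrow> s < d \<Longrightarrow> ?z + s *\<^sub>R ?n \<notin> dom"
    "\<And>s. 0 < s \<Longrightarrow> s < d \<Longrightarrow> ?z - s *\<^sub>R ?n \<in> dom"
    using dom_along_normal by metis
  have "\<forall>\<^sub>F s in at_right 0. ?z + s *\<^sub>R ?n \<notin> dom"
    unfolding eventually_at_right_field using d(1,2) by blast
  moreover have "?n \<bullet> (\<i> * ?n) = 0" by (simp add: inner_complex_def)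
  ultimately show "norm ?n = 1 \<and> ?n \<bullet> vector_derivative (bdry_curve h (cis \<theta>)) (at 0) = 0 \<and>
      (\<forall>\<^sub>F s in at_right 0. ?z + s *\<^sub>R ?n \<notin> dom)"
    by (simp add: norm_unit_normal T)
  fix n assume n: "norm n = 1 \<and> n \<bullet> vector_derivative (bdry_curve h (cis \<theta>)) (at 0) = 0 \<and>
      (\<forall>\<^sub>F s in at_right 0. ?z + s *\<^sub>R n \<notin> dom)"
  then have "n \<bullet> (\<i> * ?n) = 0" using c by (simp add: T)
  then have "n = ?n \<or> n = - ?n" using n norm_unit_normal by (intro orthogonal_unit_cases) auto
  \<comment> \<open>Along the negative normal the points lie in the domain for all small positive
    \<open>s\<close>, which is incompatible with the exterior condition in the definition.\<close>
  moreover have "n \<noteq> - ?n"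
  proof
    assume neg: "n = - ?n"
    have "\<forall>\<^sub>F s in at_right 0. ?z + s *\<^sub>R n \<in> dom"
      unfolding eventually_at_right_field using d(1,3) by (auto simp: neg)
    moreover have "\<forall>\<^sub>F s in at_right 0. ?z + s *\<^sub>R n \<notin> dom" using n by blast
    ultimately have "\<forall>\<^sub>F s::real in at_right 0. False" by eventually_elim simp
    then show False by simp
  qed
  ultimately show "n = ?n" by blast
qed

text \<open>With w = \<xi> + i \<theta> the curve is e^w, so c' = (\<xi>' + i) e^w and c'' =
  ((\<xi>' + i)^2 + \<xi>'') e^w. The common factor scales the determinant by |e^w|^2, and what
  remains is 1 + \<xi>'^2 - \<xi>''.\<close>

lemma bdry_curvature_cis:
  "bdry_curvature h (cis \<theta>) = exp (- \<xi> \<theta>) *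
     (1 + (deriv \<xi> \<theta>)\<^sup>2 - deriv (deriv \<xi>) \<theta>) / sqrt (1 + (deriv \<xi> \<theta>)\<^sup>2) ^ 3"
proof -
  let ?c = "bdry_curve h (cis \<theta>)" and ?E = "\<lambda>s. exp (Complex (\<xi> (\<theta> + s)) (\<theta> + s))"
  let ?p = "deriv \<xi> \<theta>" and ?q = "deriv (deriv \<xi>) \<theta>"
  let ?e = "exp (\<xi> \<theta>)"
  have c1: "vector_derivative ?c (at s) = Complex (deriv \<xi> (\<theta> + s)) 1 * ?E s" for s
    by (rule vector_derivative_at[OF bdry_curve_deriv])
  have "((\<lambda>s. deriv \<xi> (\<theta> + s)) has_real_derivative ?q) (at 0)"
    by (rule DERIV_chain2[of _ _ _ _ 1, simplified]) (auto intro!: derivative_eq_intros simp: \<xi>_deriv2)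
  then have "((\<lambda>s. Complex (deriv \<xi> (\<theta> + s)) 1) has_vector_derivative of_real ?q) (at 0)"
    by (auto simp: has_vector_derivative_complex_iff intro!: derivative_eq_intros)
  moreover have "(?E has_vector_derivative Complex ?p 1 * ?E 0) (at 0)"
    using bdry_curve_deriv[of \<theta> 0] by (simp add: bdry_curve_cis[abs_def])
  ultimately have "((\<lambda>s. Complex (deriv \<xi> (\<theta> + s)) 1 * ?E s) has_vector_derivative
     (Complex (deriv \<xi> (\<theta> + 0)) 1 * (Complex ?p 1 * ?E 0) + of_real ?q * ?E 0)) (at 0)"
    by (rule has_vector_derivative_mult)
  then have c2: "vector_derivative (\<lambda>r. vector_derivative ?c (at r)) (at 0) =
     (Complex ?p 1 * Complex ?p 1 + of_real ?q) * ?E 0"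
    unfolding c1 by (simp add: vector_derivative_at algebra_simps)
  have dot: "rotJ (a * e) \<bullet> (b * e) = (rotJ a \<bullet> b) * (norm e)\<^sup>2" for a b e :: complex
    unfolding cmod_power2 by (simp add: rotJ_def inner_complex_def power2_eq_square algebra_simps)
  have norm1: "norm (vector_derivative ?c (at 0)) = sqrt (1 + ?p\<^sup>2) * ?e"
    unfolding c1 norm_mult norm_exp_eq_Re by (simp add: cmod_def add.commute)
  have "rotJ (vector_derivative ?c (at 0)) \<bullet> vector_derivative (\<lambda>r. vector_derivative ?c (at r)) (at 0)
      = (1 + ?p\<^sup>2 - ?q) * ?e\<^sup>2"
    unfolding c2 unfolding c1 dot by (simp add: rotJ_def inner_complex_def power2_eq_square algebra_simps)
  then have "bdry_curvature h (cis \<theta>) = (1 + ?p\<^sup>2 - ?q) * ?e\<^sup>2 / (sqrt (1 + ?p\<^sup>2) * ?e) ^ 3"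
    by (simp add: bdry_curvature_def curve_curvature_def Let_def norm1)
  also have "\<dots> = exp (- \<xi> \<theta>) * (1 + ?p\<^sup>2 - ?q) / sqrt (1 + ?p\<^sup>2) ^ 3"
    by (simp add: power_mult_distrib exp_minus power2_eq_square power3_eq_cube divide_simps)
  finally show ?thesis .
qed

text \<open>Together with \<open>bdry_curvature_cis\<close> this makes the bracket after \<sigma> in
  the torus equation equal to minus e^\<xi> times the curvature.\<close>

lemma slope_deriv:
  "deriv (\<lambda>s. deriv \<xi> s / sqrt (1 + (deriv \<xi> s)\<^sup>2)) \<theta> = deriv (deriv \<xi>) \<theta> / sqrt (1 + (deriv \<xi> \<theta>)\<^sup>2) ^ 3"
proof (rule DERIV_imp_deriv)
  define S where "S = sqrt (1 + (deriv \<xi> \<theta>)\<^sup>2)"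
  have pos: "1 + (deriv \<xi> \<theta>)\<^sup>2 > 0" by (simp add: add_pos_nonneg)
  then have S: "S > 0" "S * S = 1 + (deriv \<xi> \<theta>)\<^sup>2" by (auto simp: S_def)
  have "((\<lambda>s. deriv \<xi> s / sqrt (1 + (deriv \<xi> s)\<^sup>2)) has_real_derivative
     (deriv (deriv \<xi>) \<theta> * S - deriv \<xi> \<theta> * (deriv \<xi> \<theta> * deriv (deriv \<xi>) \<theta> / S)) / (S * S)) (at \<theta>)"
    unfolding S_def using pos by (auto intro!: derivative_eq_intros \<xi>_deriv2 simp: field_simps)
  moreover have "deriv (deriv \<xi>) \<theta> * S - deriv \<xi> \<theta> * (deriv \<xi> \<theta> * deriv (deriv \<xi>) \<theta> / S)
     = deriv (deriv \<xi>) \<theta> * (S * S - (deriv \<xi> \<theta>)\<^sup>2) / S"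
    using S(1) by (simp add: field_simps power2_eq_square)
  ultimately show "((\<lambda>s. deriv \<xi> s / sqrt (1 + (deriv \<xi> s)\<^sup>2)) has_real_derivative
      deriv (deriv \<xi>) \<theta> / sqrt (1 + (deriv \<xi> \<theta>)\<^sup>2) ^ 3) (at \<theta>)"
    unfolding S_def[symmetric] using S by (simp add: power3_eq_cube mult.commute)
qed

lemma h_deriv: "((\<lambda>t. h (cis t)) has_real_derivative exp (\<xi> \<theta>) * deriv \<xi> \<theta>) (at \<theta>)"
proof -
  have "(\<lambda>t. h (cis t)) = (\<lambda>t. exp (\<xi> t) - 1)" by (auto simp: exp_\<xi>)
  then show ?thesis using \<xi>_deriv by (auto intro!: derivative_eq_intros)
qed

lemma Jac_cis: "Jac h (cis \<theta>) = exp (\<xi> \<theta>) * sqrt (1 + (deriv \<xi> \<theta>)\<^sup>2)"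
proof -
  have "(1 + h (cis \<theta>))\<^sup>2 + (norm (tgrad h (cis \<theta>)))\<^sup>2 = (exp (\<xi> \<theta>))\<^sup>2 * (1 + (deriv \<xi> \<theta>)\<^sup>2)"
    unfolding tgrad_cis[OF h_deriv] norm_of_real_cis exp_\<xi>[symmetric]
    by (simp add: power_mult_distrib algebra_simps)
  then show ?thesis by (simp add: Jac_def real_sqrt_mult)
qed

text \<open>\<open>Jac\<close> times the unit normal is \<open>z * Complex 1 (- \<xi>')\<close> at
  the boundary point \<open>z\<close>. Moving \<open>z\<close> to the other side of the inner
  product turns \<open>D\<close> into \<open>cnj z * D\<close>, the gradient in logarithmic
  coordinates, and \<open>DN_cyl\<close> is its product with
  \<open>Complex 1 (- \<xi>')\<close>.\<close>

lemma Jac_mult_DN: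
  assumes chi: "\<And>\<theta>. chi \<theta> = \<psi> (cis \<theta>)"
  shows "Jac h (cis \<theta>) * DN h \<psi> (cis \<theta>) = DN_cyl \<xi> chi \<theta>"
proof (cases "\<exists>\<Phi> D. dirichlet_solution h \<psi> \<Phi> D")
  case False
  then show ?thesis using DN_cyl_eq_0[OF False chi] by (simp add: DN_def)
next
  case True
  then obtain \<Phi> D where sol: "dirichlet_solution h \<psi> \<Phi> D" by blast
  let ?p = "deriv \<xi> \<theta>" and ?z = "bdry h (cis \<theta>)"
  define S where "S = sqrt (1 + ?p\<^sup>2)"
  have "1 + ?p\<^sup>2 > 0" by (simp add: add_pos_nonneg)
  then have S: "S > 0" by (simp add: S_def)
  have z: "?z = of_real (exp (\<xi> \<theta>)) * cis \<theta>" by (simp add: bdry_cis exp_eq_polar)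
  have n: "of_real (exp (\<xi> \<theta>) * S) * unit_normal \<theta> = ?z * Complex 1 (- ?p)"
    using S unfolding z unit_normal_def S_def[symmetric] by (simp add: field_simps)
  have "Jac h (cis \<theta>) * DN h \<psi> (cis \<theta>) = D ?z \<bullet> (of_real (exp (\<xi> \<theta>) * S) * unit_normal \<theta>)"
    by (simp add: DN_eq[OF sol] outer_normal_cis Jac_cis S_def inner_complex_def algebra_simps)
  also have "\<dots> = Re (cnj ?z * D ?z) - ?p * Im (cnj ?z * D ?z)"
    unfolding n by (simp add: inner_complex_def algebra_simps)
  finally show ?thesis by (simp add: DN_cyl_eq[OF sol chi] Let_def)
qed

end

section \<open>The equations\<close>

text \<open>The curve, the boundary condition and the argument of \<open>N\<close> see only values
  on the circle. The predicates \<open>harmonic_conjugate\<close> are therefore equal as functions,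
  and \<open>SOME\<close> picks the same conjugate for both data.\<close>

lemma conj_trace_cong:
  assumes h: "\<And>x. x \<in> circle \<Longrightarrow> h x = h' x" and \<psi>: "\<And>x. x \<in> circle \<Longrightarrow> \<psi> x = \<psi>' x"
    and "x \<in> circle"
  shows "conj_trace N h \<psi> x = conj_trace N h' \<psi>' x"
proof -
  have b: "bdry h y = bdry h' y" if "y \<in> circle" for y using h[OF that] by (simp add: bdry_def)
  have "bdry h ` circle = bdry h' ` circle" by (rule image_cong[OF refl b])
  then have s: "star_dom h = star_dom h'" by (simp only: star_dom_def)
  have "(\<forall>x\<in>circle. \<Phi> (bdry h x) = \<psi> x) \<longleftrightarrow> (\<forall>x\<in>circle. \<Phi> (bdry h' x) = \<psi>' x)" for \<Phi>
    using b \<psi> by simp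
  then have dir: "dirichlet_solution h \<psi> = dirichlet_solution h' \<psi>'"
    by (simp add: fun_eq_iff dirichlet_solution_def s)
  have res: "restrict h circle = restrict h' circle" "restrict \<psi> circle = restrict \<psi>' circle"
    using h \<psi> by (auto intro: restrict_ext)
  have "harmonic_conjugate N h \<psi> = harmonic_conjugate N h' \<psi>'"
    by (intro ext) (simp only: harmonic_conjugate_def s dir res)
  then show ?thesis using b[OF assms(3)] by (simp add: conj_trace_def)
qed

lemma C_circle_2_deriv:
  assumes "C_circle 2 f"
  shows "((\<lambda>t. f (cis t)) has_real_derivative deriv (\<lambda>t. f (cis t)) \<theta>) (at \<theta>)"
    and "(deriv (\<lambda>t. f (cis t)) has_real_derivative deriv (deriv (\<lambda>t. f (cis t))) \<theta>) (at \<theta>)"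
proof -
  have "(deriv ^^ j) (\<lambda>t. f (cis t)) differentiable_on UNIV" if "j < 2" for j
    using assms that unfolding C_circle_def by blast
  from this[of 0] this[of 1]
  have "(\<lambda>t. f (cis t)) differentiable (at \<theta>)" "deriv (\<lambda>t. f (cis t)) differentiable (at \<theta>)"
    by (auto simp: differentiable_on_def)
  then show "((\<lambda>t. f (cis t)) has_real_derivative deriv (\<lambda>t. f (cis t)) \<theta>) (at \<theta>)"
    and "(deriv (\<lambda>t. f (cis t)) has_real_derivative deriv (deriv (\<lambda>t. f (cis t))) \<theta>) (at \<theta>)"
    by (simp_all add: DERIV_deriv_iff_real_differentiable)
qed

lemma C_circle_1_deriv:
  assumes "C_circle 1 f"
  shows "((\<lambda>t. f (cis t)) has_real_derivative deriv (\<lambda>t. f (cis t)) \<theta>) (at \<theta>)"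
  using assms by (auto simp: C_circle_def differentiable_on_def DERIV_deriv_iff_real_differentiable)

lemma smooth_star_profileI:
  assumes h_gt: "\<And>x. x \<in> circle \<Longrightarrow> h x > - 1" and C2: "C_circle 2 h"
    and \<xi>: "\<And>\<theta>. \<xi> \<theta> = ln (1 + h (cis \<theta>))"
  shows "smooth_star_profile h \<xi>"
proof -
  define F where "F t = h (cis t)" for t
  have F_pos: "1 + F t > 0" for t using h_gt[of "cis t"] by (simp add: F_def)
  have F1: "(F has_real_derivative deriv F t) (at t)" and
    F2: "(deriv F has_real_derivative deriv (deriv F) t) (at t)" for t
    using C_circle_2_deriv[OF C2] by (auto simp: F_def[abs_def])
  have \<xi>F: "\<xi> = (\<lambda>t. ln (1 + F t))" by (auto simp: \<xi> F_def)
  have d: "(\<xi> has_real_derivative deriv F t / (1 + F t)) (at t)" for t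
    unfolding \<xi>F using F1 F_pos[of t] by (auto intro!: derivative_eq_intros)
  then have deriv_\<xi>: "deriv \<xi> = (\<lambda>t. deriv F t / (1 + F t))" by (auto intro!: DERIV_imp_deriv)
  have "\<exists>d. (deriv \<xi> has_real_derivative d) (at t)" for t
    unfolding deriv_\<xi> using F1 F2 F_pos[of t] by (auto intro!: derivative_eq_intros exI)
  then have d2: "(deriv \<xi> has_real_derivative deriv (deriv \<xi>) t) (at t)" for t
    by (metis DERIV_imp_deriv)
  show ?thesis
  proof
    show "continuous_on UNIV \<xi>" using d by (meson DERIV_isCont continuous_at_imp_continuous_on)
  qed (use h_gt \<xi> d d2 in \<open>auto simp: deriv_\<xi>\<close>)
qed

context smooth_star_profile
begin

lemma conj_trace_cyl_eq:
  assumes chi: "\<And>\<theta>. chi \<theta> = \<psi> (cis \<theta>)"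
  shows "conj_trace_cyl N \<xi> chi \<theta> = conj_trace N h \<psi> (cis \<theta>)"
proof -
  have "cis (Arg x) = x" if "x \<in> circle" for x
    using that cis_Arg[of x] by (cases "x = 0") (auto simp: sgn_eq)
  then show ?thesis unfolding conj_trace_cyl_def
    by (intro conj_trace_cong) (auto simp: exp_\<xi> chi)
qed

text \<open>The factor e^\<xi> is the one in the time derivative of h = e^\<xi> - 1. Here
  \<open>Jac / (1 + h) * DN\<close> equals e^(-\<xi>) \<open>DN_cyl\<close>, and
  \<open>Mop h\<close> equals e^\<xi> \<xi>'.\<close>

lemma circle_rhs_h_cis:
  assumes chi: "\<And>\<theta>. chi \<theta> = \<psi> (cis \<theta>)"
  shows "circle_rhs_h \<alpha> h \<psi> (cis \<theta>) = exp (\<xi> \<theta>) * torus_rhs_xi \<alpha> \<xi> chi \<theta>"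
proof -
  have "exp (- (2 * \<xi> \<theta>)) = 1 / (exp (\<xi> \<theta>))\<^sup>2" "exp (2 * \<xi> \<theta>) = (exp (\<xi> \<theta>))\<^sup>2"
    by (simp_all add: exp_minus exp_double inverse_eq_divide)
  then show ?thesis
    unfolding circle_rhs_h_def torus_rhs_xi_def Mop_cis[OF h_deriv] Jac_mult_DN[of chi \<psi>, OF chi, symmetric]
      exp_\<xi>[symmetric]
    by (simp add: field_simps power2_eq_square)
qed

lemma circle_rhs_psi_cis:
  assumes chi: "\<And>\<theta>. chi \<theta> = \<psi> (cis \<theta>)" and "C_circle 1 \<psi>"
  shows "circle_rhs_psi N \<sigma> \<alpha> h \<psi> (cis \<theta>) = torus_rhs_chi N \<sigma> \<alpha> \<xi> chi \<theta>"
proof -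
  \<comment> \<open>Naming the transcendental quantities leaves a rational identity in them, with
    \<open>1 + p\<^sup>2 = S\<^sup>2\<close> as the only relation.\<close>
  define e p c q S Q where "e = exp (\<xi> \<theta>)" and "p = deriv \<xi> \<theta>" and "c = deriv chi \<theta>"
    and "q = deriv (deriv \<xi>) \<theta>" and "S = sqrt (1 + (deriv \<xi> \<theta>)\<^sup>2)" and "Q = DN_cyl \<xi> chi \<theta>"
  note defs = e_def[symmetric] p_def[symmetric] c_def[symmetric] q_def[symmetric]
    S_def[symmetric] Q_def[symmetric]
  have "1 + (deriv \<xi> \<theta>)\<^sup>2 > 0" by (simp add: add_pos_nonneg)
  then have S: "S > 0" "1 + p\<^sup>2 = S\<^sup>2" by (auto simp: S_def p_def)
  have e: "e > 0" by (simp add: e_def)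
  have e2: "exp (- 2 * \<xi> \<theta>) = 1 / e\<^sup>2" "exp (2 * \<xi> \<theta>) = e\<^sup>2" "exp (- \<xi> \<theta>) = 1 / e"
    by (simp_all add: e_def exp_minus exp_double inverse_eq_divide)
  have "((\<lambda>t. \<psi> (cis t)) has_real_derivative c) (at \<theta>)"
    using C_circle_1_deriv[OF assms(2)] by (simp add: c_def chi[abs_def])
  note \<psi>_grad = tgrad_cis[OF this] and \<psi>_M = Mop_cis[OF this]
  have inner: "tgrad \<psi> (cis \<theta>) \<bullet> tgrad h (cis \<theta>) = c * (e * p)"
  proof -
    have dot: "(of_real a * w) \<bullet> (of_real b * w) = a * b * (norm w)\<^sup>2" for a b and w :: complex
      unfolding cmod_power2 by (simp add: inner_complex_def power2_eq_square algebra_simps)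
    show ?thesis unfolding \<psi>_grad tgrad_cis[OF h_deriv] dot defs by (simp add: norm_mult)
  qed
  have J: "Jac h (cis \<theta>) = e * S" by (simp add: Jac_cis e_def S_def)
  then have DN: "DN h \<psi> (cis \<theta>) = Q / (e * S)"
    using Jac_mult_DN[of chi \<psi> \<theta>, OF chi] e S by (simp add: Q_def field_simps)
  \<comment> \<open>The gradient term has the same denominator \<open>e * S\<close> as
    \<open>DN\<close>: the inner product contributes one \<open>e\<close>, while
    \<open>Jac * (1 + h)\<close> is \<open>e\<^sup>2 * S\<close>.\<close>
  have "DN h \<psi> (cis \<theta>) + (tgrad \<psi> (cis \<theta>) \<bullet> tgrad h (cis \<theta>)) / (Jac h (cis \<theta>) * (1 + h (cis \<theta>)))
      = (Q + p * c) / (e * S)"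
    unfolding DN inner J exp_\<xi>[symmetric] defs using e S(1) by (simp add: field_simps)
  then have "circle_rhs_psi N \<sigma> \<alpha> h \<psi> (cis \<theta>) =
      1 / 2 * ((Q + p * c) / (e * S))\<^sup>2 - c\<^sup>2 / (2 * e\<^sup>2) - \<sigma> * (1 / e * (S\<^sup>2 - q) / S ^ 3)
      + \<alpha> / 2 * c + \<alpha>\<^sup>2 / 8 * e\<^sup>2 + \<alpha> * conj_trace N h \<psi> (cis \<theta>) + \<sigma> - \<alpha>\<^sup>2 / 8"
    unfolding circle_rhs_psi_def \<psi>_M bdry_curvature_cis exp_\<xi>[symmetric] e2 defs S(2)
    using S(1) by (simp add: \<psi>_grad norm_mult)
  also have "\<dots> = 1 / e\<^sup>2 * (1 / 2 * ((Q + p * c) / S)\<^sup>2 - 1 / 2 * c\<^sup>2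
        + \<sigma> * e * (q / S ^ 3 - 1 / S))
      + \<alpha> / 2 * c + \<alpha>\<^sup>2 / 8 * e\<^sup>2 + \<alpha> * conj_trace N h \<psi> (cis \<theta>) + \<sigma> - \<alpha>\<^sup>2 / 8"
    using e S(1) by (simp add: field_simps power2_eq_square power3_eq_cube)
  also have "\<dots> = torus_rhs_chi N \<sigma> \<alpha> \<xi> chi \<theta>"
    unfolding torus_rhs_chi_def slope_deriv conj_trace_cyl_eq[of chi \<psi>, OF chi] e2 defs S(2)
    using S(1) by simp
  finally show ?thesis .
qed

end

text \<open>The right-hand sides at time \<open>t\<close> involve only the functions at that time,
  so each pair of equations is compared at fixed \<open>t\<close> and \<theta>, with the circle
  parametrized by \<open>cis\<close>.\<close>

theorem theorem3p2:
  fixes \<sigma>\<^sub>0 \<alpha>\<^sub>0 :: real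
    and N :: normalization
    and h \<psi> :: "real \<Rightarrow> complex \<Rightarrow> real"
    and \<xi> chi :: "real \<Rightarrow> real \<Rightarrow> real"
  assumes "\<sigma>\<^sub>0 > 0"
    and "\<And>t x. x \<in> circle \<Longrightarrow> h t x > - 1"
    and "\<And>t. C_circle 2 (h t)"
    and "\<And>t. C_circle 1 (\<psi> t)"
    and "\<And>t \<theta>. \<xi> t \<theta> = ln (1 + h t (cis \<theta>))"
    and "\<And>t \<theta>. chi t \<theta> = \<psi> t (cis \<theta>)"
  shows "(\<forall>t. \<forall>x\<in>circle.
            ((\<lambda>s. h s x) has_real_derivative circle_rhs_h \<alpha>\<^sub>0 (h t) (\<psi> t) x) (at t) \<and>
            ((\<lambda>s. \<psi> s x) has_real_derivative circle_rhs_psi N \<sigma>\<^sub>0 \<alpha>\<^sub>0 (h t) (\<psi> t) x) (at t))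
     \<longleftrightarrow> (\<forall>t \<theta>.
            ((\<lambda>s. \<xi> s \<theta>) has_real_derivative torus_rhs_xi \<alpha>\<^sub>0 (\<xi> t) (chi t) \<theta>) (at t) \<and>
            ((\<lambda>s. chi s \<theta>) has_real_derivative torus_rhs_chi N \<sigma>\<^sub>0 \<alpha>\<^sub>0 (\<xi> t) (chi t) \<theta>) (at t))"
proof -
  have profile: "smooth_star_profile (h t) (\<xi> t)" for t
    by (rule smooth_star_profileI) (use assms in auto)
  then have sp: "star_profile (h t) (\<xi> t)" for t by (rule smooth_star_profile.axioms)
  have exp_\<xi>: "exp (\<xi> t \<theta>) = 1 + h t (cis \<theta>)" for t \<theta>
    by (rule star_profile.exp_\<xi>[OF sp])
  have "((\<lambda>s. h s (cis \<theta>)) has_real_derivative circle_rhs_h \<alpha>\<^sub>0 (h t) (\<psi> t) (cis \<theta>)) (at t) \<longleftrightarrow>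
      ((\<lambda>s. \<xi> s \<theta>) has_real_derivative torus_rhs_xi \<alpha>\<^sub>0 (\<xi> t) (chi t) \<theta>) (at t)" for t \<theta>
  proof -
    have rhs: "circle_rhs_h \<alpha>\<^sub>0 (h t) (\<psi> t) (cis \<theta>) = exp (\<xi> t \<theta>) * torus_rhs_xi \<alpha>\<^sub>0 (\<xi> t) (chi t) \<theta>"
      by (rule smooth_star_profile.circle_rhs_h_cis[OF profile]) (rule assms(6))
    have h_eq: "(\<lambda>s. h s (cis \<theta>)) = (\<lambda>s. exp (\<xi> s \<theta>) - 1)" by (simp add: exp_\<xi>)
    have \<xi>_eq: "(\<lambda>s. \<xi> s \<theta>) = (\<lambda>s. ln (1 + h s (cis \<theta>)))" by (simp add: assms(5))
    have pos: "1 + h t (cis \<theta>) > 0" by (simp flip: exp_\<xi>)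
    \<comment> \<open>Differentiability in time is itself part of the claim and passes through
      \<open>ln\<close> in one direction and through \<open>exp\<close> in the other; positivity of
      \<open>1 + h\<close> makes the former legitimate.\<close>
    show ?thesis
    proof
      assume "((\<lambda>s. h s (cis \<theta>)) has_real_derivative circle_rhs_h \<alpha>\<^sub>0 (h t) (\<psi> t) (cis \<theta>)) (at t)"
      then show "((\<lambda>s. \<xi> s \<theta>) has_real_derivative torus_rhs_xi \<alpha>\<^sub>0 (\<xi> t) (chi t) \<theta>) (at t)"
        unfolding \<xi>_eq rhs exp_\<xi> using pos by (auto intro!: derivative_eq_intros)
    next
      assume "((\<lambda>s. \<xi> s \<theta>) has_real_derivative torus_rhs_xi \<alpha>\<^sub>0 (\<xi> t) (chi t) \<theta>) (at t)"
      then show "((\<lambda>s. h s (cis \<theta>)) has_real_derivative circle_rhs_h \<alpha>\<^sub>0 (h t) (\<psi> t) (cis \<theta>)) (at t)"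
        unfolding h_eq rhs by (auto intro!: derivative_eq_intros)
    qed
  qed
  moreover have "((\<lambda>s. \<psi> s (cis \<theta>)) has_real_derivative circle_rhs_psi N \<sigma>\<^sub>0 \<alpha>\<^sub>0 (h t) (\<psi> t) (cis \<theta>)) (at t) \<longleftrightarrow>
      ((\<lambda>s. chi s \<theta>) has_real_derivative torus_rhs_chi N \<sigma>\<^sub>0 \<alpha>\<^sub>0 (\<xi> t) (chi t) \<theta>) (at t)" for t \<theta>
    using smooth_star_profile.circle_rhs_psi_cis[OF profile[of t], of "chi t" "\<psi> t"] assms(4)
    by (simp add: assms(6))
  moreover have "(\<forall>x\<in>circle. P x) \<longleftrightarrow> (\<forall>\<theta>. P (cis \<theta>))" for P
    using circle_cis by auto
  ultimately show ?thesis by simp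
qed

end
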